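(* If $X$ is a $k^*$-metrizable $k$-space, then $$d(X)\le knw(X)=nw(X)=s(X)=ext(X)=l(X)=ml(X)\cdot d(X)=d_1(X)\le so(X)\cdot d(X).$$
   Context: All topological spaces are Hausdorff; "map" means continuous function. A subset is precompact if its closure is compact. A map $f:M\to X$ is subproper if there is $Z\subset M$ with $f(Z)=X$ such that $Z\cap f^{-1}(K)$ is precompact in $M$ for every precompact $K\subset X$. A space is $k^*$-metrizable if it is the image of a metrizable space under a subproper map. $X$ is a $k$-space if a subset $F\subset X$ is closed iff $K\cap F$ is closed in $K$ for every compact $K\subset X$. Cardinal invariants: $nw(X)$ is the smallest size of a network for $X$ (a family $\mathcal N$ of subsets such that for every open $U$ and $x\in U$ there is $N\in\mathcal N$ with $x\in N\subset U$). $knw(X)$ is the smallest size of a $k$-network (a family $\mathcal N$ of subsets such that for every open $U$ and compact $K\subset U$ there is a finite $\mathcal F\subset\mathcal N$ with $K\subset\bigcup\mathcal F\subset U$). $l(X)$ is the smallest cardinal $\kappa$ such that each open cover of $X$ has a subcover of size $\le\kappa$. $ml(X)$ is the smallest cardinal $\kappa$ such that each open cover of $X$ has an open refinement $\mathcal U$ (a cover) with $|\{U\in\mathcal U:x\in U\}|\le\kappa$ for every $x\in X$. $s(X)=\sup\{|D|:D$ is a discrete subspace of $X\}$; $ext(X)=\sup\{|D|:D$ is a closed discrete subspace of $X\}$; $d(X)$ is the smallest size of a dense set in $X$. For $A\subset X$, $\mathrm{cl}_1(A)$ is the set of limits of all sequences $(a_n)\subset A$ that converge in $X$. For ordinals $\alpha>1$: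 $\mathrm{cl}_{\alpha}(A)=\mathrm{cl}_1(\mathrm{cl}_\beta(A))$ if $\alpha=\beta+1$, and $\mathrm{cl}_\alpha(A)=\bigcup_{1\le\beta<\alpha}\mathrm{cl}_\beta(A)$ if $\alpha$ is limit. The sequential order $so(X)$ is the smallest ordinal $\alpha\ge1$ such that $\mathrm{cl}_\alpha(A)=\mathrm{cl}_{\omega_1}(A)$ for every $A\subset X$; in the product $so(X)\cdot d(X)$ it is taken as the cardinal $|so(X)|$. $d_1(X)$ is the smallest size of a subset $D\subset X$ with $\mathrm{cl}_1(D)=X$. *)

theory Defs
  imports "HOL-Analysis.Analysis"
begin

unbundle cardinal_syntax

section \<open>Least ordinals and least cardinals\<close>

text \<open>
  Ordinals are represented by well-orders up to \<open>=o\<close>, cardinals by cardinal orders up to \<open>=o\<close>.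
  The minimum is taken among the ordinals that have a representative on a fixed type \<^typ>\<open>'b\<close>.
  For a property that is invariant under \<open>=o\<close> this is the minimum among all ordinals as soon as
  one ordinal on \<^typ>\<open>'b\<close> has the property, because smaller ordinals are initial segments of it.
  The underlying type of each invariant below is large enough for that. Finite values are kept:
  no invariant is rounded up to the first infinite cardinal.
\<close>

definition least_ordinal :: "('b rel \<Rightarrow> bool) \<Rightarrow> 'b rel" where
  "least_ordinal P =
     (SOME r. Well_order r \<and> P r \<and> (\<forall>r'. Well_order r' \<and> P r' \<longrightarrow> r \<le>o r'))"

definition least_cardinal :: "('b rel \<Rightarrow> bool) \<Rightarrow> 'b rel" where
  "least_cardinal P = least_ordinal (\<lambda>r. Card_order r \<and> P r)"

lemma least_ordinal:
  assumes "Well_order r0" and "P r0"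
  shows "Well_order (least_ordinal P)" and "P (least_ordinal P)"
    and "\<And>r. Well_order r \<Longrightarrow> P r \<Longrightarrow> least_ordinal P \<le>o r"
proof -
  have "\<exists>r \<in> {r. Well_order r \<and> P r}. \<forall>r' \<in> {r. Well_order r \<and> P r}. r \<le>o r'"
    using assms by (intro exists_minim_Well_order) auto
  then have "\<exists>r. Well_order r \<and> P r \<and> (\<forall>r'. Well_order r' \<and> P r' \<longrightarrow> r \<le>o r')"
    by blast
  from someI_ex[OF this] show "Well_order (least_ordinal P)" and "P (least_ordinal P)"
    and "\<And>r. Well_order r \<Longrightarrow> P r \<Longrightarrow> least_ordinal P \<le>o r"
    unfolding least_ordinal_def by blast+
qed

lemma least_cardinal:
  assumes "Card_order r0" and "P r0"
  shows "Card_order (least_cardinal P)" and "P (least_cardinal P)"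
    and "\<And>r. Card_order r \<Longrightarrow> P r \<Longrightarrow> least_cardinal P \<le>o r"
  using least_ordinal[of r0 "\<lambda>r. Card_order r \<and> P r"] assms
  by (auto simp: least_cardinal_def card_order_on_well_order_on)


section \<open>Subproper maps and $k^*$-metrizable spaces\<close>

definition precompactin :: "'a topology \<Rightarrow> 'a set \<Rightarrow> bool" where
  "precompactin X S \<longleftrightarrow> S \<subseteq> topspace X \<and> compactin X (X closure_of S)"

definition subproper_map :: "'m topology \<Rightarrow> 'a topology \<Rightarrow> ('m \<Rightarrow> 'a) \<Rightarrow> bool" where
  "subproper_map M X f \<longleftrightarrow>
     continuous_map M X f \<and>
     (\<exists>Z \<subseteq> topspace M. f ` Z = topspace X \<and>
        (\<forall>K. precompactin X K \<longrightarrow> precompactin M (Z \<inter> f -` K)))"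

text \<open>
  A space is $k^*$-metrizable iff the following holds for some type \<^typ>\<open>'m\<close>. HOL cannot quantify
  over types inside a formula, so the type of points of the metrizable space is a parameter;
  a theorem assuming this property for an arbitrary \<^typ>\<open>'m\<close> covers all $k^*$-metrizable spaces.
  A subproper map is surjective by definition.
\<close>

definition k_star_metrizable :: "'m itself \<Rightarrow> 'a topology \<Rightarrow> bool" where
  "k_star_metrizable (_ :: 'm itself) X \<longleftrightarrow>
     Hausdorff_space X \<and>
     (\<exists>(M :: 'm topology) f. metrizable_space M \<and> subproper_map M X f)"


section \<open>Cardinal invariants\<close>

definition network :: "'a topology \<Rightarrow> 'a set set \<Rightarrow> bool" where
  "network X \<N> \<longleftrightarrow>
     \<N> \<subseteq> Pow (topspace X) \<and>
     (\<forall>U x. openin X U \<and> x \<in> U \<longrightarrow> (\<exists>N \<in> \<N>. x \<in> N \<and> N \<subseteq> U))"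

definition k_network :: "'a topology \<Rightarrow> 'a set set \<Rightarrow> bool" where
  "k_network X \<N> \<longleftrightarrow>
     \<N> \<subseteq> Pow (topspace X) \<and>
     (\<forall>U K. openin X U \<and> compactin X K \<and> K \<subseteq> U \<longrightarrow>
        (\<exists>\<F> \<subseteq> \<N>. finite \<F> \<and> K \<subseteq> \<Union>\<F> \<and> \<Union>\<F> \<subseteq> U))"

definition open_cover :: "'a topology \<Rightarrow> 'a set set \<Rightarrow> bool" where
  "open_cover X \<U> \<longleftrightarrow> (\<forall>U \<in> \<U>. openin X U) \<and> \<Union>\<U> = topspace X"

definition discrete_subspace :: "'a topology \<Rightarrow> 'a set \<Rightarrow> bool" where
  "discrete_subspace X D \<longleftrightarrow> D \<subseteq> topspace X \<and> subtopology X D = discrete_topology D"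

definition nw :: "'a topology \<Rightarrow> 'a set rel" where
  "nw X = least_cardinal (\<lambda>\<kappa>. \<exists>\<N>. network X \<N> \<and> |\<N>| =o \<kappa>)"

definition knw :: "'a topology \<Rightarrow> 'a set rel" where
  "knw X = least_cardinal (\<lambda>\<kappa>. \<exists>\<N>. k_network X \<N> \<and> |\<N>| =o \<kappa>)"

definition lindelof_number :: "'a topology \<Rightarrow> 'a set rel" where
  "lindelof_number X = least_cardinal (\<lambda>\<kappa>.
     \<forall>\<U>. open_cover X \<U> \<longrightarrow> (\<exists>\<V> \<subseteq> \<U>. open_cover X \<V> \<and> |\<V>| \<le>o \<kappa>))"

definition meta_lindelof_number :: "'a topology \<Rightarrow> 'a set rel" where
  "meta_lindelof_number X = least_cardinal (\<lambda>\<kappa>.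
     \<forall>\<U>. open_cover X \<U> \<longrightarrow>
       (\<exists>\<V>. open_cover X \<V> \<and> (\<forall>V \<in> \<V>. \<exists>U \<in> \<U>. V \<subseteq> U) \<and>
            (\<forall>x \<in> topspace X. |{V \<in> \<V>. x \<in> V}| \<le>o \<kappa>)))"

text \<open>The suprema defining spread and extent are least upper bounds; they need not be attained.\<close>

definition spread :: "'a topology \<Rightarrow> 'a rel" where
  "spread X = least_cardinal (\<lambda>\<kappa>. \<forall>D. discrete_subspace X D \<longrightarrow> |D| \<le>o \<kappa>)"

definition extent :: "'a topology \<Rightarrow> 'a rel" where
  "extent X =
     least_cardinal (\<lambda>\<kappa>. \<forall>D. closedin X D \<and> discrete_subspace X D \<longrightarrow> |D| \<le>o \<kappa>)"

definition density_number :: "'a topology \<Rightarrow> 'a rel" where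
  "density_number X =
     least_cardinal (\<lambda>\<kappa>. \<exists>D \<subseteq> topspace X. X closure_of D = topspace X \<and> |D| =o \<kappa>)"


section \<open>Iterated sequential closure\<close>

definition cl1 :: "'a topology \<Rightarrow> 'a set \<Rightarrow> 'a set" where
  "cl1 X A = {x. \<exists>a :: nat \<Rightarrow> 'a. (\<forall>n. a n \<in> A) \<and> limitin X a x sequentially}"

text \<open>
  \<open>seq_cl X r A\<close> is $\mathrm{cl}_\alpha(A)$ for the order type $\alpha$ of the well-order \<open>r\<close>.
  The ordinals below $\alpha$ are the order types of the restrictions of \<open>r\<close> to \<open>underS r m\<close>,
  where \<open>m\<close> ranges over \<open>Field r\<close>; a greatest element \<open>m\<close> exists iff $\alpha = \beta + 1$, and
  then $\beta$ is the one given by this \<open>m\<close>. Setting $\mathrm{cl}_0(A) = A$ makes the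
  successor clause yield \<open>cl1 X A\<close> for $\alpha = 1$; the limit clause ranges over $\beta \ge 1$.
\<close>

definition is_greatest :: "'b rel \<Rightarrow> 'b \<Rightarrow> bool" where
  "is_greatest r m \<longleftrightarrow> m \<in> Field r \<and> (\<forall>b \<in> Field r. (b, m) \<in> r)"

function seq_cl :: "'a topology \<Rightarrow> 'b rel \<Rightarrow> 'a set \<Rightarrow> 'a set" where
  "seq_cl X r A =
     (if \<not> Well_order r then undefined
      else if Field r = {} then A
      else if \<exists>m. is_greatest r m
        then cl1 X (seq_cl X (Restr r (underS r (THE m. is_greatest r m))) A)
      else (\<Union>m \<in> {m \<in> Field r. underS r m \<noteq> {}}. seq_cl X (Restr r (underS r m)) A))"
  by pat_completeness auto
termination
  by (relation "inv_image ordLess (\<lambda>(X, r, A). r)")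
     (auto intro: wf_inv_image wf_ordLess underS_Restr_ordLess)

declare seq_cl.simps [simp del]

abbreviation omega1 :: "nat set rel" where
  "omega1 \<equiv> cardSuc natLeq"

text \<open>A well-order has order type at least 1 iff its field is nonempty.\<close>

definition seq_order :: "'a topology \<Rightarrow> nat set rel" where
  "seq_order X = least_ordinal (\<lambda>r. Field r \<noteq> {} \<and>
     (\<forall>A \<subseteq> topspace X. seq_cl X r A = seq_cl X omega1 A))"

definition seq_density :: "'a topology \<Rightarrow> 'a rel" where
  "seq_density X =
     least_cardinal (\<lambda>\<kappa>. \<exists>D \<subseteq> topspace X. cl1 X D = topspace X \<and> |D| =o \<kappa>)"

end

theory Submission
  imports Defs
begin

text \<open>
  Let \<open>f : M \<rightarrow> X\<close> be subproper, with \<open>M\<close> metric and \<open>Z \<subseteq> M\<close> as in the definition. Lindelof number, spread,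
  network weight and the like are compared by general topology
  (\<open>extent \<le> spread \<le> nw \<le> knw\<close>, \<open>extent \<le> lindelof \<le> meta_lindelof * density\<close>), so the circle of equalities
  closes once \<open>knw\<close> and the sequential density are bounded by the extent, and \<open>nw\<close> by the
  sequential density and by \<open>so * density\<close>.

  All four bounds rest on one observation. If \<open>E \<subseteq> Z\<close> is \<open>\<epsilon>\<close>-separated, then over a compact
  \<open>K \<subseteq> X\<close> it has only finitely many points, because \<open>Z \<inter> f -` K\<close> has compact closure. Hence \<open>f ` E\<close>
  and all its subsets meet every compact set in a finite set, and as \<open>X\<close> is a \<open>k\<close>-space,
  \<open>f ` E\<close> is closed and discrete (\<open>closed_discrete_image_of_separated\<close>). Taking maximal
  \<open>1/n\<close>-separated subsets for all \<open>n\<close> gives \<open>small_dense_lift\<close>: if the closed discrete subsets of \<open>X\<close>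
  that lie in \<open>Y\<close> have size at most an infinite \<open>\<kappa>\<close>, then \<open>Z \<inter> f -` Y\<close> has a dense subset of size at
  most \<open>\<kappa>\<close>.

  For \<open>Y = X\<close> and \<open>\<kappa>\<close> the extent, the images of balls around the dense subset form a
  \<open>k\<close>-network (\<open>k_network_of_dense\<close>), and the image of the dense subset is sequentially dense
  (\<open>cl1_image_of_dense\<close>). For general \<open>Y\<close>, a convergent sequence in \<open>Y\<close> lifts to a sequence in \<open>Z\<close> with
  a convergent subsequence, so \<open>cl1 X Y\<close> is covered by the image of the closure of \<open>Z \<inter> f -` Y\<close>, and the
  images of balls again form a network at its points (\<open>network_on_cl1\<close>). With \<open>Y\<close> a sequentially
  dense set this bounds \<open>nw\<close> by the sequential density. Since a network at the points of \<open>Y\<close> bounds in turn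
  the discrete subsets of \<open>Y\<close>, the step can be iterated along the sequential order starting
  from a dense set (\<open>network_on_seq_cl\<close>); it ends with all of \<open>X\<close>, because \<open>X\<close> is a sequential space
  (\<open>sequentially_closed_imp_closed\<close>).

  These arguments need an infinite \<open>\<kappa>\<close>. A finite \<open>X\<close> is discrete, and there each invariant other
  than the meta-Lindelof number and the sequential order is squeezed between bounds
  equal to the number of points.
\<close>

text \<open>The infix \<open>=o\<close> is reserved for the equality of order types.\<close>

no_notation elt_set_eq (infix \<open>=o\<close> 50)

section \<open>Cardinal invariants as attained minima\<close>

text \<open>
  The invariants live on different types, so comparing them needs minimality also against
  cardinals \<open>\<kappa>\<close> on other types. Such a \<open>\<kappa>\<close> either has a copy on \<^typ>\<open>'b\<close>, or it is so large that it
  dominates every cardinal on \<^typ>\<open>'b\<close>.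
\<close>

lemma least_cardinal_le_any_type:
  fixes P :: "'b rel \<Rightarrow> bool" and \<kappa> :: "'k rel"
  assumes r0: "Card_order r0" "P r0" and \<kappa>: "Card_order \<kappa>"
    and P: "\<And>r :: 'b rel. Card_order r \<Longrightarrow> r =o \<kappa> \<Longrightarrow> P r"
  shows "least_cardinal P \<le>o \<kappa>"
proof (cases "|UNIV :: 'b set| \<le>o \<kappa>")
  case True
  have "least_cardinal P \<le>o r0"
    using least_cardinal(3)[of r0 P r0] r0 by blast
  also have "r0 \<le>o |UNIV :: 'b set|"
    using r0(1) card_of_Field_ordIso[of r0] card_of_mono1[of "Field r0" UNIV]
    by (meson ordIso_ordLeq_trans ordIso_symmetric subset_UNIV)
  also note True
  finally show ?thesis .
next
  case False
  then have "\<kappa> \<le>o |UNIV :: 'b set|"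
    using \<kappa> card_of_Well_order by (metis card_order_on_def ordLeq_total)
  then have "|Field \<kappa>| \<le>o |UNIV :: 'b set|"
    by (rule ordIso_ordLeq_trans[OF card_of_Field_ordIso[OF \<kappa>]])
  from iffD1[OF internalize_card_of_ordLeq2 this]
  obtain B :: "'b set" where "|Field \<kappa>| =o |B|" by blast
  then have B: "|B| =o \<kappa>"
    using card_of_Field_ordIso[OF \<kappa>] by (rule ordIso_transitive[OF ordIso_symmetric])
  then have "least_cardinal P \<le>o |B|"
    by (intro least_cardinal(3)[of r0 P, OF r0] P card_of_Card_order)
  then show ?thesis
    using B ordLeq_ordIso_trans by blast
qed

lemma network_Pow: "network X (Pow (topspace X))"
  unfolding network_def by (blast dest: openin_subset)

lemma k_network_Pow: "k_network X (Pow (topspace X))"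
  unfolding k_network_def
proof (intro conjI allI impI)
  fix U K assume "openin X U \<and> compactin X K \<and> K \<subseteq> U"
  then show "\<exists>\<F>\<subseteq>Pow (topspace X). finite \<F> \<and> K \<subseteq> \<Union>\<F> \<and> \<Union>\<F> \<subseteq> U"
    using compactin_subset_topspace by (intro exI[of _ "{K}"]) auto
qed simp

lemma
  shows Card_order_nw: "Card_order (nw X)"
    and nw_attained: "\<exists>\<N>. network X \<N> \<and> |\<N>| =o nw X"
    and nw_le: "network X \<N> \<Longrightarrow> nw X \<le>o |\<N>|"
proof -
  let ?P = "\<lambda>\<kappa>. \<exists>\<N>. network X \<N> \<and> |\<N>| =o \<kappa>"
  have P: "network X \<N> \<Longrightarrow> ?P |\<N>|" for \<N> by (metis card_of_refl)
  note least = least_cardinal[of _ ?P, OF card_of_Card_order P[OF network_Pow[of X]], folded nw_def]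
  show "Card_order (nw X)" "?P (nw X)" by (fact least)+
  show "nw X \<le>o |\<N>|" if "network X \<N>" by (rule least(3)[OF card_of_Card_order P[OF that]])
qed

lemma
  shows Card_order_knw: "Card_order (knw X)"
    and knw_attained: "\<exists>\<N>. k_network X \<N> \<and> |\<N>| =o knw X"
    and knw_le: "k_network X \<N> \<Longrightarrow> knw X \<le>o |\<N>|"
proof -
  let ?P = "\<lambda>\<kappa>. \<exists>\<N>. k_network X \<N> \<and> |\<N>| =o \<kappa>"
  have P: "k_network X \<N> \<Longrightarrow> ?P |\<N>|" for \<N> by (metis card_of_refl)
  note least = least_cardinal[of _ ?P, OF card_of_Card_order P[OF k_network_Pow[of X]], folded knw_def]
  show "Card_order (knw X)" "?P (knw X)" by (fact least)+
  show "knw X \<le>o |\<N>|" if "k_network X \<N>" by (rule least(3)[OF card_of_Card_order P[OF that]])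
qed

lemma
  shows Card_order_density: "Card_order (density_number X)"
    and density_attained:
      "\<exists>D\<subseteq>topspace X. X closure_of D = topspace X \<and> |D| =o density_number X"
    and density_le: "D \<subseteq> topspace X \<Longrightarrow> X closure_of D = topspace X \<Longrightarrow> density_number X \<le>o |D|"
proof -
  let ?P = "\<lambda>\<kappa>. \<exists>D\<subseteq>topspace X. X closure_of D = topspace X \<and> |D| =o \<kappa>"
  have P: "D \<subseteq> topspace X \<Longrightarrow> X closure_of D = topspace X \<Longrightarrow> ?P |D|" for D by (metis card_of_refl)
  note least = least_cardinal[of _ ?P, OF card_of_Card_order P[OF order_refl closure_of_topspace],
      folded density_number_def]
  show "Card_order (density_number X)" "?P (density_number X)" by (fact least)+
  show "density_number X \<le>o |D|" if "D \<subseteq> topspace X" "X closure_of D = topspace X"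
    by (rule least(3)[OF card_of_Card_order P[OF that]])
qed

lemma cl1_subset_closure_of: "cl1 X A \<subseteq> X closure_of A"
proof
  fix x assume "x \<in> cl1 X A"
  then obtain a where a: "\<And>n :: nat. a n \<in> A" and lim: "limitin X a x sequentially"
    unfolding cl1_def by blast
  have "\<exists>y. y \<in> A \<and> y \<in> T" if T: "x \<in> T" "openin X T" for T
  proof -
    have "eventually (\<lambda>n. a n \<in> T) sequentially"
      using lim T by (simp add: limitin_def)
    then obtain N where "a N \<in> T"
      using eventually_happens'[OF sequentially_bot] by blast
    with a show ?thesis by blast
  qed
  then show "x \<in> X closure_of A"
    using limitin_topspace[OF lim] by (simp add: in_closure_of)
qed

lemma cl1_increasing:
  assumes "A \<subseteq> topspace X" shows "A \<subseteq> cl1 X A"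
proof
  fix x assume "x \<in> A"
  then show "x \<in> cl1 X A"
    unfolding cl1_def mem_Collect_eq
    using assms by (intro exI[of _ "\<lambda>_. x"]) (auto simp: limitin_def)
qed

lemma cl1_subset_topspace: "cl1 X A \<subseteq> topspace X"
  by (auto simp: cl1_def limitin_def)

lemma cl1_topspace: "cl1 X (topspace X) = topspace X"
  by (intro equalityI cl1_subset_topspace cl1_increasing order_refl)

lemma
  shows Card_order_seq_density: "Card_order (seq_density X)"
    and seq_density_attained: "\<exists>D\<subseteq>topspace X. cl1 X D = topspace X \<and> |D| =o seq_density X"
    and seq_density_le: "D \<subseteq> topspace X \<Longrightarrow> cl1 X D = topspace X \<Longrightarrow> seq_density X \<le>o |D|"
proof -
  let ?P = "\<lambda>\<kappa>. \<exists>D\<subseteq>topspace X. cl1 X D = topspace X \<and> |D| =o \<kappa>"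
  have P: "D \<subseteq> topspace X \<Longrightarrow> cl1 X D = topspace X \<Longrightarrow> ?P |D|" for D by (metis card_of_refl)
  note least = least_cardinal[of _ ?P, OF card_of_Card_order P[OF order_refl cl1_topspace],
      folded seq_density_def]
  show "Card_order (seq_density X)" "?P (seq_density X)" by (fact least)+
  show "seq_density X \<le>o |D|" if "D \<subseteq> topspace X" "cl1 X D = topspace X"
    by (rule least(3)[OF card_of_Card_order P[OF that]])
qed

lemma
  fixes X :: "'a topology" and \<kappa> :: "'k rel"
  shows Card_order_spread: "Card_order (spread X)"
    and spread_bound: "discrete_subspace X D \<Longrightarrow> |D| \<le>o spread X"
    and spread_leI: "Card_order \<kappa> \<Longrightarrow> (\<And>D. discrete_subspace X D \<Longrightarrow> |D| \<le>o \<kappa>) \<Longrightarrow> spread X \<le>o \<kappa>"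
proof -
  let ?P = "\<lambda>\<kappa>. \<forall>D. discrete_subspace X D \<longrightarrow> |D| \<le>o \<kappa>"
  have P: "?P |topspace X|" by (simp add: discrete_subspace_def card_of_mono1)
  note least = least_cardinal[of _ ?P, OF card_of_Card_order P, folded spread_def]
  show "Card_order (spread X)" by (fact least)
  show "|D| \<le>o spread X" if "discrete_subspace X D" using least(2) that by blast
  show "spread X \<le>o \<kappa>" if "Card_order \<kappa>" "\<And>D. discrete_subspace X D \<Longrightarrow> |D| \<le>o \<kappa>"
    unfolding spread_def
  proof (rule least_cardinal_le_any_type[of _ ?P, OF card_of_Card_order P that(1)])
    fix r :: "'a rel" assume "r =o \<kappa>"
    then show "?P r"
      using that(2) ordLeq_ordIso_trans[OF _ ordIso_symmetric[OF \<open>r =o \<kappa>\<close>]] by blast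
  qed
qed

lemma
  fixes X :: "'a topology" and \<kappa> :: "'k rel"
  shows Card_order_extent: "Card_order (extent X)"
    and extent_bound: "closedin X D \<Longrightarrow> discrete_subspace X D \<Longrightarrow> |D| \<le>o extent X"
    and extent_leI: "Card_order \<kappa> \<Longrightarrow>
      (\<And>D. closedin X D \<Longrightarrow> discrete_subspace X D \<Longrightarrow> |D| \<le>o \<kappa>) \<Longrightarrow> extent X \<le>o \<kappa>"
proof -
  let ?P = "\<lambda>\<kappa>. \<forall>D. closedin X D \<and> discrete_subspace X D \<longrightarrow> |D| \<le>o \<kappa>"
  have P: "?P |topspace X|" by (simp add: discrete_subspace_def card_of_mono1)
  note least = least_cardinal[of _ ?P, OF card_of_Card_order P, folded extent_def]
  show "Card_order (extent X)" by (fact least)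
  show "|D| \<le>o extent X" if "closedin X D" "discrete_subspace X D" using least(2) that by blast
  show "extent X \<le>o \<kappa>"
    if "Card_order \<kappa>" "\<And>D. closedin X D \<Longrightarrow> discrete_subspace X D \<Longrightarrow> |D| \<le>o \<kappa>"
    unfolding extent_def
  proof (rule least_cardinal_le_any_type[of _ ?P, OF card_of_Card_order P that(1)])
    fix r :: "'a rel" assume "r =o \<kappa>"
    then show "?P r"
      using that(2) ordLeq_ordIso_trans[OF _ ordIso_symmetric[OF \<open>r =o \<kappa>\<close>]] by blast
  qed
qed

lemma
  fixes X :: "'a topology" and \<kappa> :: "'k rel"
  shows Card_order_lindelof: "Card_order (lindelof_number X)"
    and lindelof_subcover: "open_cover X \<U> \<Longrightarrow>
      \<exists>\<V>\<subseteq>\<U>. open_cover X \<V> \<and> |\<V>| \<le>o lindelof_number X"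
    and lindelof_leI: "Card_order \<kappa> \<Longrightarrow>
      (\<And>\<U>. open_cover X \<U> \<Longrightarrow> \<exists>\<V>\<subseteq>\<U>. open_cover X \<V> \<and> |\<V>| \<le>o \<kappa>) \<Longrightarrow> lindelof_number X \<le>o \<kappa>"
proof -
  let ?P = "\<lambda>\<kappa>. \<forall>\<U>. open_cover X \<U> \<longrightarrow> (\<exists>\<V>\<subseteq>\<U>. open_cover X \<V> \<and> |\<V>| \<le>o \<kappa>)"
  have P: "?P |UNIV :: 'a set set|" 
    by (intro allI impI exI conjI) (auto intro: card_of_mono1)
  note least = least_cardinal[of _ ?P, OF card_of_Card_order P, folded lindelof_number_def]
  show "Card_order (lindelof_number X)" by (fact least)
  show "\<exists>\<V>\<subseteq>\<U>. open_cover X \<V> \<and> |\<V>| \<le>o lindelof_number X" if "open_cover X \<U>"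
    using least(2) that by blast
  show "lindelof_number X \<le>o \<kappa>"
    if \<kappa>: "Card_order \<kappa>" and V: "\<And>\<U>. open_cover X \<U> \<Longrightarrow> \<exists>\<V>\<subseteq>\<U>. open_cover X \<V> \<and> |\<V>| \<le>o \<kappa>"
    unfolding lindelof_number_def
  proof (rule least_cardinal_le_any_type[of _ ?P, OF card_of_Card_order P \<kappa>], intro allI impI)
    fix r :: "'a set rel" and \<U> assume "r =o \<kappa>" "open_cover X \<U>"
    then obtain \<V> where "\<V> \<subseteq> \<U>" "open_cover X \<V>" "|\<V>| \<le>o \<kappa>" using V by blast
    then show "\<exists>\<V>\<subseteq>\<U>. open_cover X \<V> \<and> |\<V>| \<le>o r"
      using ordLeq_ordIso_trans[OF _ ordIso_symmetric[OF \<open>r =o \<kappa>\<close>]] by blast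
  qed
qed

lemma
  fixes X :: "'a topology" and \<kappa> :: "'k rel"
  shows Card_order_meta_lindelof: "Card_order (meta_lindelof_number X)"
    and meta_lindelof_refinement: "open_cover X \<U> \<Longrightarrow>
      \<exists>\<V>. open_cover X \<V> \<and> (\<forall>V \<in> \<V>. \<exists>U \<in> \<U>. V \<subseteq> U) \<and>
          (\<forall>x \<in> topspace X. |{V \<in> \<V>. x \<in> V}| \<le>o meta_lindelof_number X)"
    and meta_lindelof_leI: "Card_order \<kappa> \<Longrightarrow>
      (\<And>\<U>. open_cover X \<U> \<Longrightarrow>
        \<exists>\<V>. open_cover X \<V> \<and> (\<forall>V \<in> \<V>. \<exists>U \<in> \<U>. V \<subseteq> U) \<and>
            (\<forall>x \<in> topspace X. |{V \<in> \<V>. x \<in> V}| \<le>o \<kappa>)) \<Longrightarrow> meta_lindelof_number X \<le>o \<kappa>"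
proof -
  let ?Q = "\<lambda>\<U> \<V> \<kappa>. open_cover X \<V> \<and> (\<forall>V \<in> \<V>. \<exists>U \<in> \<U>. V \<subseteq> U) \<and>
            (\<forall>x \<in> topspace X. |{V \<in> \<V>. x \<in> V}| \<le>o \<kappa>)"
  let ?P = "\<lambda>\<kappa>. \<forall>\<U>. open_cover X \<U> \<longrightarrow> (\<exists>\<V>. ?Q \<U> \<V> \<kappa>)"
  have P: "?P |UNIV :: 'a set set|"
  proof (intro allI impI)
    fix \<U> assume "open_cover X \<U>"
    then have "?Q \<U> \<U> |UNIV :: 'a set set|" by (simp add: card_of_mono1) blast
    then show "\<exists>\<V>. ?Q \<U> \<V> |UNIV :: 'a set set|" ..
  qed
  note least = least_cardinal[of _ ?P, OF card_of_Card_order P, folded meta_lindelof_number_def]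
  show "Card_order (meta_lindelof_number X)" by (fact least)
  show "\<exists>\<V>. ?Q \<U> \<V> (meta_lindelof_number X)" if "open_cover X \<U>"
    using least(2) that by blast
  show "meta_lindelof_number X \<le>o \<kappa>"
    if \<kappa>: "Card_order \<kappa>" and Q: "\<And>\<U>. open_cover X \<U> \<Longrightarrow> \<exists>\<V>. ?Q \<U> \<V> \<kappa>"
    unfolding meta_lindelof_number_def
  proof (rule least_cardinal_le_any_type[of _ ?P, OF card_of_Card_order P \<kappa>], intro allI impI)
    fix r :: "'a set rel" and \<U> assume "r =o \<kappa>" "open_cover X \<U>"
    then obtain \<V> where "?Q \<U> \<V> \<kappa>" using Q by blast
    then have "?Q \<U> \<V> r"
      using ordLeq_ordIso_trans[OF _ ordIso_symmetric[OF \<open>r =o \<kappa>\<close>]]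
      by (elim conjE) (intro conjI ballI, blast+)
    then show "\<exists>\<V>. ?Q \<U> \<V> r" ..
  qed
qed


section \<open>Inequalities between the invariants of a Hausdorff space\<close>

text \<open>
  The members need not be contained in \<open>Y\<close>; this spares intersecting with \<open>Y\<close>, which grows
  from step to step in the iteration of sequential closures.
\<close>

definition network_on :: "'a topology \<Rightarrow> 'a set \<Rightarrow> 'a set set \<Rightarrow> bool" where
  "network_on X Y \<N> \<longleftrightarrow>
     \<N> \<subseteq> Pow (topspace X) \<and>
     (\<forall>U x. openin X U \<and> x \<in> U \<and> x \<in> Y \<longrightarrow> (\<exists>N \<in> \<N>. x \<in> N \<and> N \<subseteq> U))"

lemma network_on_topspace: "network_on X (topspace X) \<N> \<longleftrightarrow> network X \<N>"
  unfolding network_on_def network_def by (meson openin_subset subsetD)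

lemma network_on_UN:
  assumes "\<And>i. i \<in> I \<Longrightarrow> network_on X (Y i) (\<N> i)"
  shows "network_on X (\<Union>i\<in>I. Y i) (\<Union>i\<in>I. \<N> i)"
  using assms unfolding network_on_def by (simp add: UN_subset_iff) (metis UN_iff)

lemma closed_discrete_subspaceI:
  assumes "\<And>S. S \<subseteq> D \<Longrightarrow> closedin X S"
  shows "closedin X D" and "discrete_subspace X D"
proof -
  show D: "closedin X D" using assms by blast
  then have sub: "D \<subseteq> topspace X" by (rule closedin_subset)
  have "openin (subtopology X D) {x}" if "x \<in> D" for x
  proof -
    have "openin X (topspace X - (D - {x}))"
      using assms[of "D - {x}"] by blast
    moreover have "{x} = (topspace X - (D - {x})) \<inter> D"
      using that sub by blast
    ultimately show ?thesis
      unfolding openin_subtopology by blast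
  qed
  then have "discrete_topology D = subtopology X D"
    using sub by (simp add: discrete_topology_unique Int_absorb1)
  then show "discrete_subspace X D"
    using sub by (simp add: discrete_subspace_def)
qed

lemma discrete_subspace_isolating:
  assumes "discrete_subspace X D" "x \<in> D"
  obtains U where "openin X U" "U \<inter> D = {x}"
proof -
  have "openin (subtopology X D) {x}"
    using assms by (simp add: discrete_subspace_def)
  then show ?thesis
    using that unfolding openin_subtopology by metis
qed

text \<open>
  For each \<open>x \<in> D\<close> a network member between \<open>x\<close> and a neighbourhood isolating \<open>x\<close> in \<open>D\<close> meets \<open>D\<close> only
  in \<open>x\<close>, so different points get different members.
\<close>

lemma card_discrete_le_network_on:
  assumes \<N>: "network_on X Y \<N>" and D: "discrete_subspace X D" "D \<subseteq> Y"
  shows "|D| \<le>o |\<N>|"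
proof -
  have "\<exists>N\<in>\<N>. N \<inter> D = {x}" if x: "x \<in> D" for x
  proof -
    obtain U where U: "openin X U" "U \<inter> D = {x}"
      using discrete_subspace_isolating[OF D(1) x] .
    moreover have "x \<in> U" "x \<in> Y" using U x D(2) by auto
    ultimately obtain N where "N \<in> \<N>" "x \<in> N" "N \<subseteq> U"
      using \<N> unfolding network_on_def by meson
    then show ?thesis using U(2) x by blast
  qed
  then obtain n where n: "\<And>x. x \<in> D \<Longrightarrow> n x \<in> \<N> \<and> n x \<inter> D = {x}"
    by metis
  then have "inj_on n D"
    by (metis inj_onI singleton_inject)
  moreover have "n ` D \<subseteq> \<N>"
    using n by blast
  ultimately show ?thesis
    using card_of_ordLeq by blast
qed

lemma spread_le_nw: "spread X \<le>o nw X"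
proof (rule spread_leI[OF Card_order_nw])
  fix D assume D: "discrete_subspace X D"
  obtain \<N> where \<N>: "network X \<N>" "|\<N>| =o nw X"
    using nw_attained by blast
  have "|D| \<le>o |\<N>|"
    using card_discrete_le_network_on[of X "topspace X" \<N> D] \<N>(1) D
    by (simp add: network_on_topspace discrete_subspace_def)
  then show "|D| \<le>o nw X"
    using \<N>(2) by (rule ordLeq_ordIso_trans)
qed

lemma extent_le_spread: "extent X \<le>o spread X"
  by (intro extent_leI Card_order_spread spread_bound)

lemma nw_le_knw: "nw X \<le>o knw X"
proof -
  obtain \<N> where \<N>: "k_network X \<N>" "|\<N>| =o knw X"
    using knw_attained by blast
  have "\<exists>N\<in>\<N>. x \<in> N \<and> N \<subseteq> U" if U: "openin X U" "x \<in> U" for U x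
  proof -
    have "compactin X {x}" using that openin_subset by fastforce
    then obtain \<F> where "\<F> \<subseteq> \<N> \<and> finite \<F> \<and> {x} \<subseteq> \<Union>\<F> \<and> \<Union>\<F> \<subseteq> U"
      using \<N>(1)[unfolded k_network_def, THEN conjunct2, rule_format, of U "{x}"] U by auto
    then show ?thesis by blast
  qed
  moreover have "\<N> \<subseteq> Pow (topspace X)"
    using \<N>(1) unfolding k_network_def by blast
  ultimately have "network X \<N>"
    unfolding network_def by blast
  from ordLeq_ordIso_trans[OF nw_le[OF this] \<N>(2)] show ?thesis .
qed

text \<open>
  For nonempty \<open>D\<close>, the complements of \<open>D - {x}\<close>, for \<open>x \<in> D\<close>, form an open cover without proper subcovers.
\<close>

lemma extent_le_lindelof: "extent X \<le>o lindelof_number X"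
proof (rule extent_leI[OF Card_order_lindelof])
  fix D assume D: "closedin X D" "discrete_subspace X D"
  show "|D| \<le>o lindelof_number X"
  proof (cases "D = {}")
    case True
    then show ?thesis using card_of_empty1[OF _ ] Card_order_lindelof[of X]
      by (simp add: card_of_empty1 card_order_on_well_order_on)
  next
    case False
    define U where "U x = topspace X - (D - {x})" for x
    have sub: "D \<subseteq> topspace X" using D(1) by (rule closedin_subset)
    have "openin X (U x)" if x: "x \<in> D" for x
    proof -
      obtain V where V: "openin X V" "V \<inter> D = {x}"
        using discrete_subspace_isolating[OF D(2) x] .
      have "U x = (topspace X - D) \<union> V"
        using V(2) openin_subset[OF V(1)] x sub unfolding U_def by blast
      moreover have "openin X (topspace X - D)" using D(1) by blast
      ultimately show ?thesis using V(1) by (simp add: openin_Un)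
    qed
    moreover have "\<Union>(U ` D) = topspace X"
      using False unfolding U_def by blast
    ultimately have "open_cover X (U ` D)"
      unfolding open_cover_def by blast
    then obtain \<V> where \<V>: "\<V> \<subseteq> U ` D" "open_cover X \<V>" "|\<V>| \<le>o lindelof_number X"
      using lindelof_subcover by blast
    \<comment> \<open>\<^term>\<open>U x\<close> is the only member of the cover that contains \<^term>\<open>x\<close>.\<close>
    have only: "U y = U x" if "x \<in> D" "x \<in> U y" for x y
      using that unfolding U_def by blast
    have "U ` D \<subseteq> \<V>"
    proof
      fix W assume "W \<in> U ` D"
      then obtain x where x: "x \<in> D" "W = U x" by blast
      then have "x \<in> \<Union>\<V>" using \<V>(2) sub unfolding open_cover_def by blast
      then obtain y where "U y \<in> \<V>" "x \<in> U y" using \<V>(1) by blast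
      with only[OF x(1)] x(2) show "W \<in> \<V>" by simp
    qed
    moreover have "inj_on U D"
    proof (rule inj_onI)
      fix x y assume "x \<in> D" "y \<in> D" "U x = U y"
      moreover have "x \<in> U x" using \<open>x \<in> D\<close> sub by (auto simp: U_def)
      ultimately show "x = y" by (auto simp: U_def)
    qed
    ultimately have "|D| \<le>o |\<V>|"
      using card_of_ordLeq by blast
    then show ?thesis using \<V>(3) by (rule ordLeq_transitive)
  qed
qed

text \<open>
  Every nonempty member of an open refinement contains a point of the dense set, and each of these
  points lies in few members; so the refinement is small, and with it the subcover that it
  selects.
\<close>

lemma lindelof_le_meta_lindelof_times_density:
  "lindelof_number X \<le>o meta_lindelof_number X *c density_number X"
proof (rule lindelof_leI[OF Card_order_cprod])
  fix \<U> assume "open_cover X \<U>"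
  from meta_lindelof_refinement[OF this]
  obtain \<V> where \<V>: "open_cover X \<V>" and refines: "\<forall>V\<in>\<V>. \<exists>U\<in>\<U>. V \<subseteq> U"
    and order: "\<forall>x\<in>topspace X. |{V \<in> \<V>. x \<in> V}| \<le>o meta_lindelof_number X"
    by (elim exE conjE)
  from density_attained[of X]
  obtain D where D: "D \<subseteq> topspace X" "X closure_of D = topspace X" "|D| =o density_number X"
    by (elim exE conjE)
  define \<W> where "\<W> = \<V> - {{}}"
  have "\<forall>V\<in>\<W>. \<exists>U. U \<in> \<U> \<and> V \<subseteq> U"
    using refines unfolding \<W>_def by blast
  then obtain u where u: "\<And>V. V \<in> \<W> \<Longrightarrow> u V \<in> \<U> \<and> V \<subseteq> u V"
    by metis
  have open_W: "openin X W" if "W \<in> \<W>" for W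
    using \<V> that unfolding \<W>_def open_cover_def by blast
  have "\<W> \<subseteq> (\<Union>x\<in>D. {V \<in> \<V>. x \<in> V})"
  proof
    fix W assume W: "W \<in> \<W>"
    then obtain y where "y \<in> W" unfolding \<W>_def by blast
    moreover from this have "y \<in> X closure_of D"
      using D(2) open_W[OF W] openin_subset by fastforce
    ultimately obtain x where "x \<in> D" "x \<in> W"
      using open_W[OF W] unfolding in_closure_of by blast
    then show "W \<in> (\<Union>x\<in>D. {V \<in> \<V>. x \<in> V})"
      using W unfolding \<W>_def by blast
  qed
  then have "|\<W>| \<le>o |SIGMA x : D. {V \<in> \<V>. x \<in> V}|"
    using ordLeq_transitive[OF card_of_mono1 card_of_UNION_Sigma] by blast
  also have "|SIGMA x : D. {V \<in> \<V>. x \<in> V}| \<le>o |SIGMA x : D. Field (meta_lindelof_number X)|"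
  proof (rule card_of_Sigma_mono1, rule ballI)
    fix x assume "x \<in> D"
    then have "|{V \<in> \<V>. x \<in> V}| \<le>o meta_lindelof_number X" using order D(1) by blast
    then show "|{V \<in> \<V>. x \<in> V}| \<le>o |Field (meta_lindelof_number X)|"
      by (rule ordLeq_ordIso_trans[OF _ ordIso_symmetric[OF card_of_Field_ordIso[OF Card_order_meta_lindelof]]])
  qed
  also have "|SIGMA x : D. Field (meta_lindelof_number X)| =o meta_lindelof_number X *c density_number X"
    using ordIso_transitive[OF cprod_com cprod_cong2[OF D(3)]]
    by (simp add: cprod_def Field_card_of)
  finally have "|\<W>| \<le>o meta_lindelof_number X *c density_number X" .
  then have "|u ` \<W>| \<le>o meta_lindelof_number X *c density_number X"
    by (rule ordLeq_transitive[OF card_of_image])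
  moreover have "\<Union>(u ` \<W>) = topspace X"
  proof -
    have "\<Union>(u ` \<W>) \<subseteq> \<Union>\<U>" using u by blast
    also have "\<Union>\<U> = topspace X" using \<open>open_cover X \<U>\<close> unfolding open_cover_def by blast
    finally have "\<Union>(u ` \<W>) \<subseteq> topspace X" .
    moreover have "topspace X \<subseteq> \<Union>\<W>" using \<V> unfolding open_cover_def \<W>_def by blast
    moreover have "\<Union>\<W> \<subseteq> \<Union>(u ` \<W>)" using u by blast
    ultimately show ?thesis by blast
  qed
  moreover have "u ` \<W> \<subseteq> \<U>" using u by blast
  ultimately show "\<exists>\<V>\<subseteq>\<U>. open_cover X \<V> \<and> |\<V>| \<le>o meta_lindelof_number X *c density_number X"
    using \<open>open_cover X \<U>\<close> unfolding open_cover_def by (intro exI[of _ "u ` \<W>"]) auto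
qed

lemma density_le_nw: "density_number X \<le>o nw X"
proof -
  obtain \<N> where \<N>: "network X \<N>" "|\<N>| =o nw X"
    using nw_attained by blast
  define p where "p N = (SOME x. x \<in> N)" for N :: "'a set"
  define D where "D = p ` (\<N> - {{}})"
  have p: "p N \<in> N" if "x \<in> N" for x N
    using that unfolding p_def by (rule someI)
  have sub: "D \<subseteq> topspace X"
  proof
    fix y assume "y \<in> D"
    then obtain N x where "N \<in> \<N>" "x \<in> N" "y = p N" unfolding D_def by blast
    then show "y \<in> topspace X" using p[of x N] \<N>(1) unfolding network_def by blast
  qed
  have "topspace X \<subseteq> X closure_of D"
  proof
    fix x assume x: "x \<in> topspace X"
    have "\<exists>y. y \<in> D \<and> y \<in> T" if T: "x \<in> T" "openin X T" for T
    proof -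
      obtain N where N: "N \<in> \<N>" "x \<in> N" "N \<subseteq> T"
        using \<N>(1) T unfolding network_def by blast
      then have "p N \<in> D" unfolding D_def by blast
      with p[OF N(2)] N(3) show ?thesis by blast
    qed
    with x show "x \<in> X closure_of D" by (simp add: in_closure_of)
  qed
  then have "X closure_of D = topspace X"
    by (simp add: closure_of_subset_topspace subset_antisym)
  then have "density_number X \<le>o |D|" by (rule density_le[OF sub])
  also have "|D| \<le>o |\<N> - {{}}|" unfolding D_def by (rule card_of_image)
  also have "|\<N> - {{}}| \<le>o |\<N>|" by (rule card_of_mono1) blast
  also note \<N>(2)
  finally show ?thesis .
qed

lemma lindelof_le_nw: "lindelof_number X \<le>o nw X"
proof (rule lindelof_leI[OF Card_order_nw])
  fix \<U> assume \<U>: "open_cover X \<U>"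
  obtain \<N> where \<N>: "network X \<N>" "|\<N>| =o nw X"
    using nw_attained by blast
  define \<M> where "\<M> = {N \<in> \<N>. \<exists>U\<in>\<U>. N \<subseteq> U}"
  have "\<forall>N\<in>\<M>. \<exists>U. U \<in> \<U> \<and> N \<subseteq> U"
    unfolding \<M>_def by blast
  then obtain u where u: "\<And>N. N \<in> \<M> \<Longrightarrow> u N \<in> \<U> \<and> N \<subseteq> u N"
    by metis
  have "|u ` \<M>| \<le>o |\<N>|"
    by (rule ordLeq_transitive[OF card_of_image card_of_mono1]) (auto simp: \<M>_def)
  then have "|u ` \<M>| \<le>o nw X"
    using \<N>(2) by (rule ordLeq_ordIso_trans)
  moreover have "\<Union>(u ` \<M>) = topspace X"
  proof
    show "\<Union>(u ` \<M>) \<subseteq> topspace X"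
      using u \<U> unfolding open_cover_def by blast
    show "topspace X \<subseteq> \<Union>(u ` \<M>)"
    proof
      fix x assume "x \<in> topspace X"
      then obtain U where U: "U \<in> \<U>" "x \<in> U" "openin X U"
        using \<U> unfolding open_cover_def by blast
      then obtain N where N: "N \<in> \<N>" "x \<in> N" "N \<subseteq> U"
        using \<N>(1) unfolding network_def by blast
      then have "N \<in> \<M>" unfolding \<M>_def using U by blast
      with u N(2) show "x \<in> \<Union>(u ` \<M>)" by blast
    qed
  qed
  moreover have "u ` \<M> \<subseteq> \<U>" using u by blast
  ultimately show "\<exists>\<V>\<subseteq>\<U>. open_cover X \<V> \<and> |\<V>| \<le>o nw X"
    using \<U> unfolding open_cover_def by (intro exI[of _ "u ` \<M>"]) auto
qed

lemma meta_lindelof_le_lindelof: "meta_lindelof_number X \<le>o lindelof_number X"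
proof (rule meta_lindelof_leI[OF Card_order_lindelof])
  fix \<U> assume "open_cover X \<U>"
  then obtain \<V> where \<V>: "\<V> \<subseteq> \<U>" "open_cover X \<V>" "|\<V>| \<le>o lindelof_number X"
    using lindelof_subcover by blast
  have "|{V \<in> \<V>. x \<in> V}| \<le>o lindelof_number X" for x
    by (rule ordLeq_transitive[OF card_of_mono1 \<V>(3)]) blast
  with \<V> show "\<exists>\<V>. open_cover X \<V> \<and> (\<forall>V \<in> \<V>. \<exists>U \<in> \<U>. V \<subseteq> U) \<and>
            (\<forall>x \<in> topspace X. |{V \<in> \<V>. x \<in> V}| \<le>o lindelof_number X)"
    by blast
qed

lemma density_le_seq_density: "density_number X \<le>o seq_density X"
proof -
  from seq_density_attained[of X]
  obtain D where D: "D \<subseteq> topspace X" "cl1 X D = topspace X" "|D| =o seq_density X"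
    by (elim exE conjE)
  then have "X closure_of D = topspace X"
    using cl1_subset_closure_of[of X D] by (simp add: closure_of_subset_topspace subset_antisym)
  from ordLeq_ordIso_trans[OF density_le[OF D(1) this] D(3)] show ?thesis .
qed


subsection \<open>Finite and infinite spaces\<close>

lemma Hausdorff_finite_subset:
  assumes "Hausdorff_space X" "finite S" "S \<subseteq> topspace X"
  shows "closedin X S" and "discrete_subspace X S"
proof -
  have "closedin X T" if "T \<subseteq> S" for T
    using assms(1) order_trans[OF that assms(3)] finite_subset[OF that assms(2)]
    by (rule closedin_Hausdorff_finite)
  from closed_discrete_subspaceI[OF this] show "closedin X S" "discrete_subspace X S" by blast+
qed

text \<open>
  A supremum of finite cardinals that are unbounded is infinite even when no infinite
  set witnesses it; this happens for the extent of an infinite compact space.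
\<close>

lemma Cinfinite_if_bounds_finite_subsets:
  assumes "Card_order \<kappa>" "infinite A" and bound: "\<And>F. F \<subseteq> A \<Longrightarrow> finite F \<Longrightarrow> |F| \<le>o \<kappa>"
  shows "Cinfinite \<kappa>"
proof -
  have "\<not> finite (Field \<kappa>)"
  proof
    assume fin: "finite (Field \<kappa>)"
    obtain F where F: "F \<subseteq> A" "finite F" "card F = Suc (card (Field \<kappa>))"
      using infinite_arbitrarily_large[OF assms(2)] by blast
    have "|F| \<le>o |Field \<kappa>|"
      by (rule ordLeq_ordIso_trans[OF bound[OF F(1,2)]
            ordIso_symmetric[OF card_of_Field_ordIso[OF assms(1)]]])
    then obtain g where "inj_on g F" "g ` F \<subseteq> Field \<kappa>"
      using card_of_ordLeq[of F "Field \<kappa>"] by blast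
    then have "card F \<le> card (Field \<kappa>)"
      using fin by (rule card_inj_on_le)
    with F(3) show False by simp
  qed
  with assms(1) show ?thesis by (simp add: cinfinite_def)
qed

lemma Cinfinite_extent:
  assumes "Hausdorff_space X" "infinite (topspace X)"
  shows "Cinfinite (extent X)"
  using Card_order_extent assms(2)
  by (rule Cinfinite_if_bounds_finite_subsets)
    (intro extent_bound Hausdorff_finite_subset[OF assms(1)])

lemma finite_dense_subset_Hausdorff:
  assumes "Hausdorff_space X" "D \<subseteq> topspace X" "X closure_of D = topspace X" "finite D"
  shows "D = topspace X"
  using Hausdorff_finite_subset(1)[OF assms(1,4,2)] assms(3) closure_of_closedin by metis

lemma Cinfinite_density:
  assumes "Hausdorff_space X" "infinite (topspace X)"
  shows "Cinfinite (density_number X)"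
proof -
  from density_attained[of X]
  obtain D where D: "D \<subseteq> topspace X" "X closure_of D = topspace X" "|D| =o density_number X"
    by (elim exE conjE)
  have "infinite D"
    using finite_dense_subset_Hausdorff[OF assms(1) D(1,2)] assms(2) by auto
  then have "Cinfinite |D|" by (simp add: cinfinite_def Field_card_of card_of_card_order_on)
  with D(3) show ?thesis by (rule Cinfinite_cong)
qed

lemma card_le_density_if_finite:
  assumes "Hausdorff_space X" "finite (topspace X)"
  shows "|topspace X| \<le>o density_number X"
proof -
  from density_attained[of X]
  obtain D where D: "D \<subseteq> topspace X" "X closure_of D = topspace X" "|D| =o density_number X"
    by (elim exE conjE)
  have "D = topspace X"
    by (rule finite_dense_subset_Hausdorff[OF assms(1) D(1,2) finite_subset[OF D(1) assms(2)]])
  with D(3) show ?thesis by (simp add: ordIso_imp_ordLeq)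
qed

lemma card_le_extent_if_finite:
  assumes "Hausdorff_space X" "finite (topspace X)"
  shows "|topspace X| \<le>o extent X"
  by (intro extent_bound Hausdorff_finite_subset assms order_refl)

lemma knw_le_card_if_finite:
  assumes "finite (topspace X)"
  shows "knw X \<le>o |topspace X|"
proof -
  have "k_network X ((\<lambda>x. {x}) ` topspace X)"
    unfolding k_network_def
  proof (intro conjI allI impI)
    fix U K assume "openin X U \<and> compactin X K \<and> K \<subseteq> U"
    moreover from this have K: "K \<subseteq> topspace X" by (simp add: compactin_subset_topspace)
    moreover have "finite K" by (rule finite_subset[OF K assms])
    ultimately show "\<exists>\<F>\<subseteq>(\<lambda>x. {x}) ` topspace X. finite \<F> \<and> K \<subseteq> \<Union>\<F> \<and> \<Union>\<F> \<subseteq> U"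
      by (intro exI[of _ "(\<lambda>x. {x}) ` K"]) auto
  qed auto
  from ordLeq_transitive[OF knw_le[OF this] card_of_image] show ?thesis .
qed

lemma meta_lindelof_times_density_le_nw:
  assumes "Hausdorff_space X"
  shows "meta_lindelof_number X *c density_number X \<le>o nw X"
proof (cases "finite (topspace X)")
  case False
  have "Cinfinite (extent X)" using assms False by (rule Cinfinite_extent)
  moreover have "extent X \<le>o nw X"
    by (rule ordLeq_transitive[OF extent_le_spread spread_le_nw])
  ultimately have "Cinfinite (nw X)"
    using cinfinite_mono Card_order_nw by (intro conjI) blast+
  with ordLeq_transitive[OF meta_lindelof_le_lindelof lindelof_le_nw] density_le_nw
    Card_order_meta_lindelof Card_order_density
  show ?thesis by (rule cprod_cinfinite_bound)
next
  case True
  \<comment> \<open>A finite Hausdorff space is discrete, so the open cover by singletons refines every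
     open cover.\<close>
  have "meta_lindelof_number X \<le>o |{()}|"
  proof (rule meta_lindelof_leI[OF card_of_Card_order])
    fix \<U> assume \<U>: "open_cover X \<U>"
    let ?S = "(\<lambda>x. {x}) ` topspace X"
    have "openin X {x}" if "x \<in> topspace X" for x
    proof -
      have "closedin X (topspace X - {x})"
        by (rule Hausdorff_finite_subset(1)[OF assms]) (use True in auto)
      then have "openin X (topspace X - (topspace X - {x}))" by blast
      with that show ?thesis by (simp add: double_diff)
    qed
    then have "open_cover X ?S" unfolding open_cover_def by blast
    moreover have "\<forall>V\<in>?S. \<exists>U\<in>\<U>. V \<subseteq> U" using \<U> unfolding open_cover_def by blast
    moreover have "\<forall>x\<in>topspace X. |{V \<in> ?S. x \<in> V}| \<le>o |{()}|"
    proof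
      fix x assume "x \<in> topspace X"
      then have "{V \<in> ?S. x \<in> V} = {{x}}" by blast
      then show "|{V \<in> ?S. x \<in> V}| \<le>o |{()}|" by (simp add: card_of_singl_ordLeq)
    qed
    ultimately show "\<exists>\<V>. open_cover X \<V> \<and> (\<forall>V \<in> \<V>. \<exists>U \<in> \<U>. V \<subseteq> U) \<and>
            (\<forall>x \<in> topspace X. |{V \<in> \<V>. x \<in> V}| \<le>o |{()}| )" by blast
  qed
  then have "meta_lindelof_number X *c density_number X \<le>o |{()}| *c density_number X"
    by (rule cprod_mono1)
  also have "|{()}| *c density_number X = |{()} \<times> Field (density_number X)|"
    by (simp add: cprod_def Field_card_of)
  also have "|{()} \<times> Field (density_number X)| \<le>o |Field (density_number X)|"
    by (rule card_of_ordLeqI[of snd]) (auto simp: inj_on_def)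
  also have "|Field (density_number X)| =o density_number X"
    by (rule card_of_Field_ordIso[OF Card_order_density])
  also note density_le_nw
  finally show ?thesis .
qed


section \<open>Separated sets in the metrizable preimage\<close>

lemma card_of_nat_le_Cinfinite:
  assumes "Cinfinite \<kappa>" shows "|UNIV :: nat set| \<le>o \<kappa>"
  by (rule ordIso_ordLeq_trans[OF card_of_nat natLeq_ordLeq_cinfinite[OF assms]])

lemma (in Metric_space) maximal_separated_subset:
  assumes "S \<subseteq> M" "0 < \<epsilon>"
  shows "\<exists>E\<subseteq>S. (\<forall>x\<in>E. \<forall>y\<in>E. x \<noteq> y \<longrightarrow> \<epsilon> \<le> d x y) \<and> (\<forall>x\<in>S. \<exists>e\<in>E. d x e < \<epsilon>)"
proof -
  let ?sep = "\<lambda>E. \<forall>x\<in>E. \<forall>y\<in>E. x \<noteq> y \<longrightarrow> \<epsilon> \<le> d x y"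
  have "\<exists>E\<in>{E. E \<subseteq> S \<and> ?sep E}. \<forall>F\<in>{E. E \<subseteq> S \<and> ?sep E}. E \<subseteq> F \<longrightarrow> F = E"
  proof (rule subset_Zorn')
    fix C assume C: "subset.chain {E. E \<subseteq> S \<and> ?sep E} C"
    then have sub: "\<And>E. E \<in> C \<Longrightarrow> E \<subseteq> S \<and> ?sep E"
      and total: "\<And>E F. E \<in> C \<Longrightarrow> F \<in> C \<Longrightarrow> E \<subseteq> F \<or> F \<subseteq> E"
      unfolding subset_chain_def by blast+
    have "\<epsilon> \<le> d x y" if xy: "x \<in> \<Union>C" "y \<in> \<Union>C" "x \<noteq> y" for x y
    proof -
      obtain E F where EF: "E \<in> C" "x \<in> E" "F \<in> C" "y \<in> F" using xy by blast
      then obtain G where "G \<in> C" "x \<in> G" "y \<in> G" using total[of E F] by blast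
      with sub xy(3) show ?thesis by blast
    qed
    moreover have "\<Union>C \<subseteq> S" using sub by blast
    ultimately show "\<Union>C \<in> {E. E \<subseteq> S \<and> ?sep E}" by blast
  qed
  then obtain E where mem: "E \<in> {E. E \<subseteq> S \<and> ?sep E}"
    and max: "\<forall>F\<in>{E. E \<subseteq> S \<and> ?sep E}. E \<subseteq> F \<longrightarrow> F = E"
    by (elim bexE)
  from mem have E: "E \<subseteq> S" "?sep E" by simp_all
  have "\<exists>e\<in>E. d x e < \<epsilon>" if x: "x \<in> S" for x
  proof (rule ccontr)
    assume far: "\<not> (\<exists>e\<in>E. d x e < \<epsilon>)"
    have "?sep (insert x E)"
      using E(2) far by (auto simp: not_less commute)
    then have "insert x E = E"
      using max[rule_format, of "insert x E"] x E(1) by (simp add: subset_insertI)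
    then have "x \<in> E" by blast
    moreover have "d x x < \<epsilon>" using x assms by auto
    ultimately show False using far by blast
  qed
  with E show ?thesis by (intro exI[of _ E]) simp
qed

text \<open>
  Finitely many balls of radius \<open>\<epsilon>/2\<close> cover \<open>K\<close>, and each contains at most one point of \<open>E\<close>.
\<close>

lemma (in Metric_space) finite_separated_subset_of_compact:
  assumes K: "compactin mtopology K" and "E \<subseteq> K" "0 < \<epsilon>"
    and sep: "\<And>x y. x \<in> E \<Longrightarrow> y \<in> E \<Longrightarrow> x \<noteq> y \<Longrightarrow> \<epsilon> \<le> d x y"
  shows "finite E"
proof -
  have "mtotally_bounded K" using K by (rule compactin_imp_mtotally_bounded)
  then obtain A where A: "finite A" "K \<subseteq> (\<Union>a\<in>A. mball a (\<epsilon>/2))"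
    unfolding mtotally_bounded_def using \<open>0 < \<epsilon>\<close> by (meson half_gt_zero)
  have "\<forall>x\<in>E. \<exists>a. a \<in> A \<and> x \<in> mball a (\<epsilon>/2)"
    using A(2) \<open>E \<subseteq> K\<close> by blast
  then obtain a where a: "\<And>x. x \<in> E \<Longrightarrow> a x \<in> A \<and> x \<in> mball (a x) (\<epsilon>/2)"
    by metis
  have "inj_on a E"
  proof (rule inj_onI, rule ccontr)
    fix x y assume xy: "x \<in> E" "y \<in> E" "a x = a y" "x \<noteq> y"
    then have "a x \<in> M" "x \<in> M" "y \<in> M" "d (a x) x < \<epsilon>/2" "d (a x) y < \<epsilon>/2"
      using a[OF xy(1)] a[OF xy(2)] by auto
    then have "d x y < \<epsilon>"
      using triangle[of x "a x" y] commute[of x "a x"] by linarith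
    with sep[OF xy(1,2,4)] show False by simp
  qed
  moreover have "finite (a ` E)"
    using A(1) a by (meson finite_subset image_subsetI)
  ultimately show ?thesis by (metis finite_imageD)
qed

text \<open>
  A subproper map onto a Hausdorff \<open>k\<close>-space, with the metric and the set \<open>Z\<close> fixed.
  A compact subset of \<open>X\<close> is closed, so it is precompact.
\<close>

locale subproper_metric_image = Metric_space M d
  for M :: "'m set" and d +
  fixes X :: "'a topology" and f :: "'m \<Rightarrow> 'a" and Z :: "'m set"
  assumes Hausdorff: "Hausdorff_space X"
    and k_space: "k_space X"
    and continuous: "continuous_map mtopology X f"
    and Z_subset: "Z \<subseteq> M"
    and image_Z: "f ` Z = topspace X"
    and compact_lift: "compactin X K \<Longrightarrow> compactin mtopology (mtopology closure_of (Z \<inter> f -` K))"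
begin

lemma lift_subset_closure: "Z \<inter> f -` K \<subseteq> mtopology closure_of (Z \<inter> f -` K)"
  using Z_subset by (intro closure_of_subset) auto

lemma f_in_topspace: "x \<in> M \<Longrightarrow> f x \<in> topspace X"
  using continuous continuous_map_image_subset_topspace by fastforce

lemma lift_point: "x \<in> topspace X \<Longrightarrow> \<exists>z. z \<in> Z \<and> f z = x"
  unfolding image_Z[symmetric] by auto

lemma image_compact_lift:
  assumes K: "compactin X K"
  shows "f ` (mtopology closure_of (Z \<inter> f -` K)) = K"
proof
  have "closedin X K" using Hausdorff K by (rule compactin_imp_closedin)
  moreover have "mtopology closure_of (Z \<inter> f -` K) \<subseteq> M"
    using closure_of_subset_topspace by force
  moreover have "f ` (mtopology closure_of (Z \<inter> f -` K)) \<subseteq> X closure_of (f ` (Z \<inter> f -` K))"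
    using continuous continuous_map_image_closure_subset by blast
  moreover have "X closure_of (f ` (Z \<inter> f -` K)) \<subseteq> X closure_of K"
    by (rule closure_of_mono) blast
  ultimately show "f ` (mtopology closure_of (Z \<inter> f -` K)) \<subseteq> K"
    using closure_of_closedin by fastforce
  have "K \<subseteq> f ` Z"
    using compactin_subset_topspace[OF K] image_Z by simp
  then have "K \<subseteq> f ` (Z \<inter> f -` K)" by auto
  with lift_subset_closure[of K] show "K \<subseteq> f ` (mtopology closure_of (Z \<inter> f -` K))"
    by blast
qed

lemma finite_separated_lift:
  assumes "E \<subseteq> Z" "0 < \<epsilon>" and sep: "\<And>x y. x \<in> E \<Longrightarrow> y \<in> E \<Longrightarrow> x \<noteq> y \<Longrightarrow> \<epsilon> \<le> d x y"
    and K: "compactin X K"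
  shows "finite (E \<inter> f -` K)"
proof (rule finite_separated_subset_of_compact[OF compact_lift[OF K] _ \<open>0 < \<epsilon>\<close>])
  show "E \<inter> f -` K \<subseteq> mtopology closure_of (Z \<inter> f -` K)"
    using lift_subset_closure assms(1) by blast
qed (use sep in auto)

text \<open>
  Every subset of \<open>f ` E\<close> meets each compact set in a finite set, hence is closed in the \<open>k\<close>-space \<open>X\<close>;
  and a set all of whose subsets are closed is discrete.
\<close>

lemma closed_discrete_image_of_separated:
  assumes "E \<subseteq> Z" "0 < \<epsilon>" and sep: "\<And>x y. x \<in> E \<Longrightarrow> y \<in> E \<Longrightarrow> x \<noteq> y \<Longrightarrow> \<epsilon> \<le> d x y"
  shows "closedin X (f ` E)" and "discrete_subspace X (f ` E)"
proof -
  have "closedin X S" if S: "S \<subseteq> f ` E" for S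
  proof -
    have sub: "S \<subseteq> topspace X" using S assms(1) image_Z by blast
    have "closedin (subtopology X K) (K \<inter> S)" if K: "compactin X K" for K
    proof -
      have "finite (f ` (E \<inter> f -` K))"
        using finite_separated_lift[OF assms K] by blast
      then have "finite (K \<inter> S)"
        by (rule finite_subset[rotated]) (use S in blast)
      then have "closedin X (K \<inter> S)"
        using Hausdorff sub by (intro closedin_Hausdorff_finite) auto
      then show ?thesis
        by (rule closedin_subset_topspace) blast
    qed
    with sub show ?thesis using k_space unfolding k_space_def by blast
  qed
  from closed_discrete_subspaceI[OF this]
  show "closedin X (f ` E)" "discrete_subspace X (f ` E)" by blast+
qed

text \<open>
  The union over \<open>n\<close> of maximal \<open>1/(n+1)\<close>-separated subsets is dense. The image of each is closed and
  discrete, so it has size at most \<open>\<kappa>\<close>; its fibres are finite because points are compact.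
\<close>

lemma small_dense_lift:
  assumes \<kappa>: "Cinfinite \<kappa>"
    and bound: "\<And>D. D \<subseteq> Y \<Longrightarrow> closedin X D \<Longrightarrow> discrete_subspace X D \<Longrightarrow> |D| \<le>o \<kappa>"
  obtains E where "E \<subseteq> Z \<inter> f -` Y" "|E| \<le>o \<kappa>" "Z \<inter> f -` Y \<subseteq> mtopology closure_of E"
proof -
  let ?P = "\<lambda>n E. E \<subseteq> Z \<inter> f -` Y
      \<and> (\<forall>x\<in>E. \<forall>y\<in>E. x \<noteq> y \<longrightarrow> inverse (Suc n) \<le> d x y)
      \<and> (\<forall>x\<in>Z \<inter> f -` Y. \<exists>e\<in>E. d x e < inverse (Suc n))"
  have "\<exists>E. ?P n E" for n
  proof -
    have "Z \<inter> f -` Y \<subseteq> M" "0 < inverse (real (Suc n))" using Z_subset by auto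
    then show ?thesis by (rule maximal_separated_subset)
  qed
  then have "\<forall>n. \<exists>E. ?P n E" ..
  from choice[OF this] obtain E where "\<forall>n :: nat. ?P n (E n)" ..
  then have E: "E n \<subseteq> Z \<inter> f -` Y"
      "\<forall>x\<in>E n. \<forall>y\<in>E n. x \<noteq> y \<longrightarrow> inverse (Suc n) \<le> d x y"
      "\<forall>x\<in>Z \<inter> f -` Y. \<exists>e\<in>E n. d x e < inverse (Suc n)" for n
    by simp_all
  have card_E: "|E n| \<le>o \<kappa>" for n
  proof -
    have sub: "E n \<subseteq> Z" using E(1)[of n] by blast
    have pos: "0 < inverse (real (Suc n))" by simp
    have sep: "inverse (real (Suc n)) \<le> d x y" if "x \<in> E n" "y \<in> E n" "x \<noteq> y" for x y
      using E(2)[of n] that by simp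
    have "f ` E n \<subseteq> Y" using E(1)[of n] by blast
    then have card_image: "|f ` E n| \<le>o \<kappa>"
      using closed_discrete_image_of_separated[OF sub pos sep] by (rule bound)
    have "\<forall>x\<in>f ` E n. |E n \<inter> f -` {x}| \<le>o \<kappa>"
    proof
      fix x assume "x \<in> f ` E n"
      then have "compactin X {x}" using sub image_Z by auto
      then have "finite (E n \<inter> f -` {x})"
        using finite_separated_lift[OF sub pos sep] by blast
      then have "|E n \<inter> f -` {x}| <o \<kappa>"
        using \<kappa> by (intro Cfinite_ordLess_Cinfinite)
          (auto simp: cfinite_def Field_card_of card_of_card_order_on)
      then show "|E n \<inter> f -` {x}| \<le>o \<kappa>" by (rule ordLess_imp_ordLeq)
    qed
    then have "|\<Union>x\<in>f ` E n. E n \<inter> f -` {x}| \<le>o \<kappa>"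
      by (rule UNION_Cinfinite_bound[OF card_image _ \<kappa>])
    moreover have "(\<Union>x\<in>f ` E n. E n \<inter> f -` {x}) = E n" by blast
    ultimately show ?thesis by simp
  qed
  have "|\<Union>n. E n| \<le>o \<kappa>"
    by (intro UNION_Cinfinite_bound card_of_nat_le_Cinfinite \<kappa> ballI card_E)
  moreover have "(\<Union>n. E n) \<subseteq> Z \<inter> f -` Y" by (rule UN_least) (rule E(1))
  moreover have "Z \<inter> f -` Y \<subseteq> mtopology closure_of (\<Union>n. E n)"
  proof
    fix x assume x: "x \<in> Z \<inter> f -` Y"
    have "\<exists>y\<in>\<Union>n. E n. y \<in> mball x r" if r: "0 < r" for r
    proof -
      obtain n where n: "inverse (real (Suc n)) < r" using reals_Archimedean[OF r] by blast
      obtain e where e: "e \<in> E n" "d x e < inverse (real (Suc n))" using E(3)[of n] x by blast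
      moreover have "e \<in> M" "x \<in> M" using e(1) E(1)[of n] x Z_subset by blast+
      ultimately show ?thesis using n by (intro bexI[of _ e]) auto
    qed
    moreover have "x \<in> M" using x Z_subset by blast
    ultimately show "x \<in> mtopology closure_of (\<Union>n. E n)"
      by (simp add: metric_closure_of)
  qed
  ultimately show ?thesis by (intro that)
qed

subsection \<open>Networks from balls around a dense set\<close>

text \<open>
  At a point of the closure of \<open>E\<close>, the balls of radius \<open>1/(n+1)\<close> that contain it and are centred
  in \<open>E\<close> form a neighbourhood base. With \<open>E\<close> small, this is the source of all small networks below.
\<close>

lemma ball_around_dense_point:
  assumes "z \<in> mtopology closure_of E" "openin X U" "f z \<in> U"
  obtains e n where "e \<in> E" "z \<in> mball e (inverse (Suc n))" "f ` mball e (inverse (Suc n)) \<subseteq> U"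
proof -
  have z: "z \<in> M" using assms(1) by (simp add: metric_closure_of)
  have "openin mtopology {x \<in> topspace mtopology. f x \<in> U}"
    using continuous assms(2) by (rule openin_continuous_map_preimage)
  then obtain r where r: "0 < r" "mball z r \<subseteq> {x \<in> M. f x \<in> U}"
    using z assms(3) unfolding openin_mtopology by auto
  obtain n where n: "inverse (real (Suc n)) < r / 2" using reals_Archimedean[of "r/2"] r(1) by auto
  have "0 < inverse (real (Suc n))" by simp
  then obtain e where e: "e \<in> E" "e \<in> mball z (inverse (Suc n))"
    using assms(1) unfolding metric_closure_of by blast
  have "mball e (inverse (Suc n)) \<subseteq> mball z r"
  proof
    fix x assume x: "x \<in> mball e (inverse (Suc n))"
    then have "d z x \<le> d z e + d e x" using z e by (intro triangle) auto
    with x e(2) n show "x \<in> mball z r" by auto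
  qed
  with r(2) have "f ` mball e (inverse (Suc n)) \<subseteq> U" by blast
  moreover have "z \<in> mball e (inverse (Suc n))" using e(2) by (auto simp: commute)
  ultimately show ?thesis by (intro that[OF e(1)])
qed

lemma card_balls_le:
  assumes "Cinfinite \<kappa>" "|E| \<le>o \<kappa>"
  shows "|(\<lambda>(e, n). g e n) ` (E \<times> (UNIV :: nat set))| \<le>o \<kappa>"
proof -
  have "|E \<times> (UNIV :: nat set)| \<le>o \<kappa>"
    using assms card_of_nat_le_Cinfinite[OF assms(1)]
    by (intro card_of_Times_ordLeq_infinite_Field) (simp_all add: cinfinite_def)
  then show ?thesis by (rule ordLeq_transitive[OF card_of_image])
qed

text \<open>
  The closure of \<open>Z \<inter> f -` K\<close> is compact and \<open>f\<close> maps it into \<open>K\<close>, so finitely many balls with image in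
  \<open>U\<close> cover it; the images of their traces on \<open>Z\<close> cover \<open>K\<close>.
\<close>

lemma k_network_of_dense:
  assumes \<kappa>: "Cinfinite \<kappa>" and E: "|E| \<le>o \<kappa>" "Z \<subseteq> mtopology closure_of E"
  shows "\<exists>\<N>. k_network X \<N> \<and> |\<N>| \<le>o \<kappa>"
proof (intro exI conjI)
  let ?B = "\<lambda>e (n::nat). f ` (Z \<inter> mball e (inverse (Suc n)))"
  let ?\<N> = "(\<lambda>(e, n). ?B e n) ` (E \<times> UNIV)"
  show "|?\<N>| \<le>o \<kappa>" by (rule card_balls_le[OF \<kappa> E(1)])
  show "k_network X ?\<N>"
    unfolding k_network_def
  proof (intro conjI allI impI)
    show "?\<N> \<subseteq> Pow (topspace X)" using image_Z by auto
    fix U K assume UK: "openin X U \<and> compactin X K \<and> K \<subseteq> U"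
    let ?C = "mtopology closure_of (Z \<inter> f -` K)"
    let ?\<B> = "{mball e (inverse (Suc n)) | e n. e \<in> E \<and> f ` mball e (inverse (Suc n)) \<subseteq> U}"
    have "?C \<subseteq> \<Union>?\<B>"
    proof
      fix z assume z: "z \<in> ?C"
      have "mtopology closure_of (Z \<inter> f -` K) \<subseteq> mtopology closure_of E"
        by (rule closure_of_minimal) (use E(2) in auto)
      then have "z \<in> mtopology closure_of E" using z by blast
      moreover have "f z \<in> U" using z image_compact_lift UK by blast
      ultimately obtain e n where "e \<in> E" "z \<in> mball e (inverse (Suc n))"
          "f ` mball e (inverse (Suc n)) \<subseteq> U"
        using UK ball_around_dense_point by metis
      then show "z \<in> \<Union>?\<B>" by blast
    qed
    moreover have "\<forall>B\<in>?\<B>. openin mtopology B" by auto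
    moreover have "compactin mtopology ?C" using UK compact_lift by blast
    ultimately obtain \<F> where \<F>: "finite \<F>" "\<F> \<subseteq> ?\<B>" "?C \<subseteq> \<Union>\<F>"
      unfolding compactin_def by meson
    let ?\<G> = "(\<lambda>B. f ` (Z \<inter> B)) ` \<F>"
    have "?\<G> \<subseteq> ?\<N>" using \<F>(2) by fast
    moreover have "K \<subseteq> \<Union>?\<G>"
    proof
      fix x assume "x \<in> K"
      then obtain z where z: "z \<in> Z" "f z = x"
        using UK compactin_subset_topspace[of X K] lift_point[of x] by auto
      then have "z \<in> ?C" using lift_subset_closure \<open>x \<in> K\<close> by blast
      then show "x \<in> \<Union>?\<G>" using \<F>(3) z by blast
    qed
    moreover have "\<Union>?\<G> \<subseteq> U" using \<F>(2) by blast
    ultimately show "\<exists>\<F>\<subseteq>?\<N>. finite \<F> \<and> K \<subseteq> \<Union>\<F> \<and> \<Union>\<F> \<subseteq> U"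
      using \<F>(1) by (intro exI[of _ ?\<G>]) auto
  qed
qed

lemma cl1_image_of_dense:
  assumes E: "E \<subseteq> Z" "Z \<subseteq> mtopology closure_of E"
  shows "cl1 X (f ` E) = topspace X"
proof (intro equalityI cl1_subset_topspace subsetI)
  fix x assume "x \<in> topspace X"
  from lift_point[OF this] obtain z where z: "z \<in> Z" "f z = x" by (elim exE conjE)
  then have "z \<in> mtopology closure_of E" using E(2) by blast
  then obtain \<sigma> where \<sigma>: "range \<sigma> \<subseteq> E \<inter> M" "limitin mtopology \<sigma> z sequentially"
    unfolding closure_of_sequentially by auto
  have "limitin X (f \<circ> \<sigma>) x sequentially"
    using continuous_map_limit[OF continuous \<sigma>(2)] z(2) by simp
  moreover have "\<forall>n. (f \<circ> \<sigma>) n \<in> f ` E" using \<sigma>(1) by auto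
  ultimately show "x \<in> cl1 X (f ` E)" unfolding cl1_def by blast
qed

text \<open>
  A convergent sequence together with its limit is compact. Hence any lift of it to \<open>Z\<close> has a convergent
  subsequence, whose limit lies over the limit of the sequence. That limit need not be in \<open>Z\<close>, which is why the
  closure appears.
\<close>

lemma cl1_subset_image_closure:
  assumes Y: "Y \<subseteq> topspace X"
  shows "cl1 X Y \<subseteq> f ` (mtopology closure_of (Z \<inter> f -` Y))"
proof
  fix x assume "x \<in> cl1 X Y"
  then obtain a where a: "\<And>n :: nat. a n \<in> Y" and lim: "limitin X a x sequentially"
    unfolding cl1_def by blast
  let ?K = "insert x (range a)"
  have K: "compactin X ?K"
    using lim by (rule compactin_sequence_with_limit) (use a Y in auto)
  have "\<forall>n. \<exists>z. z \<in> Z \<and> f z = a n"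
    by (intro allI lift_point subsetD[OF Y] a)
  from choice[OF this] obtain z where z: "z n \<in> Z" "f (z n) = a n" for n by auto
  have "range z \<subseteq> Z \<inter> f -` ?K" using z by auto
  then have "range z \<subseteq> mtopology closure_of (Z \<inter> f -` ?K)"
    using lift_subset_closure[of ?K] by blast
  then obtain w r where r: "strict_mono (r :: nat \<Rightarrow> nat)" and w: "limitin mtopology (z \<circ> r) w sequentially"
    using compact_lift[OF K] unfolding compactin_sequentially by blast
  have "limitin X (f \<circ> (z \<circ> r)) (f w) sequentially"
    using continuous w by (rule continuous_map_limit)
  moreover have "f \<circ> (z \<circ> r) = a \<circ> r" using z(2) by auto
  moreover have "limitin X (a \<circ> r) x sequentially"
    using r lim by (rule limitin_subsequence)
  ultimately have "f w = x"
    using Hausdorff limitin_Hausdorff_unique[of X "a \<circ> r" "f w" sequentially x] by simp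
  moreover have "w \<in> mtopology closure_of (Z \<inter> f -` Y)"
    unfolding closure_of_sequentially
    using w z a Z_subset limitin_topspace[OF w]
    by (auto intro!: exI[of _ "z \<circ> r"])
  ultimately show "x \<in> f ` (mtopology closure_of (Z \<inter> f -` Y))" by blast
qed

text \<open>
  The whole balls are used here, and not their traces on \<open>Z\<close> as in the \<open>k\<close>-network, since the lifted limits lie in
  the closure of \<open>Z \<inter> f -` Y\<close> and may lie outside \<open>Z\<close>.
\<close>

lemma network_on_cl1:
  assumes \<kappa>: "Cinfinite \<kappa>" and Y: "Y \<subseteq> topspace X"
    and bound: "\<And>D. D \<subseteq> Y \<Longrightarrow> closedin X D \<Longrightarrow> discrete_subspace X D \<Longrightarrow> |D| \<le>o \<kappa>"
  shows "\<exists>\<N>. network_on X (cl1 X Y) \<N> \<and> |\<N>| \<le>o \<kappa>"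
proof -
  obtain E where E: "E \<subseteq> Z \<inter> f -` Y" "|E| \<le>o \<kappa>" "Z \<inter> f -` Y \<subseteq> mtopology closure_of E"
    by (rule small_dense_lift[OF \<kappa> bound])
  let ?\<N> = "(\<lambda>(e, n). f ` mball e (inverse (Suc n))) ` (E \<times> UNIV)"
  have "network_on X (cl1 X Y) ?\<N>"
    unfolding network_on_def
  proof (intro conjI allI impI)
    show "?\<N> \<subseteq> Pow (topspace X)" using f_in_topspace by auto
    fix U x assume Ux: "openin X U \<and> x \<in> U \<and> x \<in> cl1 X Y"
    then obtain z where z: "z \<in> mtopology closure_of (Z \<inter> f -` Y)" "x = f z"
      using cl1_subset_image_closure[OF Y] by blast
    have "mtopology closure_of (Z \<inter> f -` Y) \<subseteq> mtopology closure_of E"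
      by (rule closure_of_minimal) (use E(3) in auto)
    then have "z \<in> mtopology closure_of E" using z(1) by blast
    then obtain e n where "e \<in> E" "z \<in> mball e (inverse (Suc n))"
        "f ` mball e (inverse (Suc n)) \<subseteq> U"
      using Ux z(2) ball_around_dense_point by metis
    then show "\<exists>N\<in>?\<N>. x \<in> N \<and> N \<subseteq> U"
      using z(2) by (intro bexI[of _ "f ` mball e (inverse (Suc n))"]) auto
  qed
  with card_balls_le[OF \<kappa> E(2)] show ?thesis by blast
qed

end


section \<open>Transfinite sequential closures\<close>

lemma is_greatest_unique:
  assumes "Well_order r" "is_greatest r m" shows "(THE m. is_greatest r m) = m"
proof (rule the_equality)
  fix b assume "is_greatest r b"
  with assms show "b = m"
    unfolding is_greatest_def order_on_defs antisym_def by blast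
qed (fact assms(2))

lemma seq_cl_empty: "Well_order r \<Longrightarrow> Field r = {} \<Longrightarrow> seq_cl X r A = A"
  by (simp add: seq_cl.simps)

lemma seq_cl_greatest:
  assumes "Well_order r" "is_greatest r m"
  shows "seq_cl X r A = cl1 X (seq_cl X (Restr r (underS r m)) A)"
proof -
  have "Field r \<noteq> {}" "\<exists>m. is_greatest r m"
    using assms(2) unfolding is_greatest_def by blast+
  then show ?thesis
    using assms(1) is_greatest_unique[OF assms] by (subst seq_cl.simps) simp
qed

lemma seq_cl_limit:
  assumes "Well_order r" "Field r \<noteq> {}" "\<nexists>m. is_greatest r m"
  shows "seq_cl X r A =
    (\<Union>m \<in> {m \<in> Field r. underS r m \<noteq> {}}. seq_cl X (Restr r (underS r m)) A)"
  using assms by (subst seq_cl.simps) auto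

lemma Well_order_total:
  assumes "Well_order r" "a \<in> Field r" "b \<in> Field r" shows "(a, b) \<in> r \<or> (b, a) \<in> r"
  using wo_rel.TOTALS[of r] assms by (simp add: wo_rel_def)

lemma Well_order_antisym:
  assumes "Well_order r" "(a, b) \<in> r" "(b, a) \<in> r" shows "a = b"
  using wo_rel.ANTISYM[of r] assms by (auto simp: wo_rel_def antisym_def)

lemma Well_order_underS_induct [consumes 1, case_names below]:
  assumes "Well_order r"
    and "\<And>r. Well_order r \<Longrightarrow> (\<And>m. m \<in> Field r \<Longrightarrow> P (Restr r (underS r m))) \<Longrightarrow> P r"
  shows "P r"
  using assms(1)
proof (induction r rule: wf_induct_rule[OF wf_ordLess])
  case (1 r)
  show ?case
  proof (rule assms(2)[OF 1(2)])
    fix m assume "m \<in> Field r"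
    then have "Restr r (underS r m) <o r"
      using 1(2) by (intro underS_Restr_ordLess) auto
    with 1 show "P (Restr r (underS r m))"
      using Well_order_Restr by blast
  qed
qed

text \<open>
  A property of sets passes to \<^term>\<open>seq_cl X r A\<close> if it is inherited by sequential closures and by
  unions indexed by a subset of the field of \<open>r\<close>. The fixed set \<open>F\<close> bounds the index sets of all the
  unions that occur below \<open>r\<close>.
\<close>

lemma seq_cl_closure_induct:
  fixes r :: "'b rel" and F :: "'b set"
  assumes "Well_order r" "Field r \<subseteq> F" "Q A" and cl1: "\<And>B. Q B \<Longrightarrow> Q (cl1 X B)"
    and UN: "\<And>(I :: 'b set) B. I \<subseteq> F \<Longrightarrow> (\<And>i. i \<in> I \<Longrightarrow> Q (B i)) \<Longrightarrow> Q (\<Union>i\<in>I. B i)"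
  shows "Q (seq_cl X r A)"
  using assms(1,2)
proof (induction r rule: Well_order_underS_induct)
  case (below r)
  have IH: "Q (seq_cl X (Restr r (underS r m)) A)" if m: "m \<in> Field r" for m
  proof (rule below(2)[OF m])
    have "Field (Restr r (underS r m)) \<subseteq> Field r" by (rule mono_Field) blast
    with below(3) show "Field (Restr r (underS r m)) \<subseteq> F" by blast
  qed
  consider "Field r = {}" | m where "is_greatest r m" | "Field r \<noteq> {}" "\<nexists>m. is_greatest r m"
    by blast
  then show ?case
  proof cases
    case 1
    with below(1) \<open>Q A\<close> show ?thesis by (simp add: seq_cl_empty)
  next
    case (2 m)
    then have "m \<in> Field r" by (simp add: is_greatest_def)
    then show ?thesis
      unfolding seq_cl_greatest[OF below(1) 2] by (intro cl1 IH)
  next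
    case 3
    show ?thesis
      unfolding seq_cl_limit[OF below(1) 3]
      by (rule UN) (use below(3) IH in auto)
  qed
qed

lemma seq_cl_subset_topspace:
  assumes "Well_order r" "A \<subseteq> topspace X"
  shows "seq_cl X r A \<subseteq> topspace X"
  using assms(1) order_refl assms(2)
  by (rule seq_cl_closure_induct[where Q = "\<lambda>B. B \<subseteq> topspace X"])
    (simp_all add: cl1_subset_topspace UN_least)

lemma seq_cl_increasing:
  assumes "Well_order r" "A \<subseteq> topspace X"
  shows "A \<subseteq> seq_cl X r A"
  using assms(1)
proof (induction r rule: Well_order_underS_induct)
  case (below r)
  consider "Field r = {}" | m where "is_greatest r m" | "Field r \<noteq> {}" "\<nexists>m. is_greatest r m"
    by blast
  then show ?case
  proof cases
    case 1
    with below(1) show ?thesis by (simp add: seq_cl_empty)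
  next
    case (2 m)
    then have "m \<in> Field r" by (simp add: is_greatest_def)
    then have "A \<subseteq> seq_cl X (Restr r (underS r m)) A" by (rule below(2))
    also have "\<dots> \<subseteq> cl1 X \<dots>"
      by (intro cl1_increasing seq_cl_subset_topspace Well_order_Restr below(1) assms(2))
    finally show ?thesis
      by (simp add: seq_cl_greatest[OF below(1) 2])
  next
    case 3
    then obtain a b where ab: "a \<in> Field r" "b \<in> Field r" "(b, a) \<notin> r"
      unfolding is_greatest_def by blast
    then have "(a, b) \<in> r" "a \<noteq> b"
      using Well_order_total[OF below(1), of a b] Well_order_total[OF below(1), of b b] by auto
    then have "underS r b \<noteq> {}" unfolding underS_def by blast
    with below(2)[OF ab(2)] ab(2) show ?thesis
      unfolding seq_cl_limit[OF below(1) 3] by blast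
  qed
qed

text \<open>
  An initial segment of an initial segment of \<open>r\<close> is an initial segment of \<open>r\<close>.
\<close>

lemma Restr_underS_Restr:
  assumes r: "Well_order r" and ij: "(i, j) \<in> r" "i \<noteq> j"
  defines "s \<equiv> Restr r (underS r j)"
  shows "i \<in> Field s" and "Restr s (underS s i) = Restr r (underS r i)"
proof -
  have trans: "\<And>a b c. (a, b) \<in> r \<Longrightarrow> (b, c) \<in> r \<Longrightarrow> (a, c) \<in> r"
    and antisym: "\<And>a b. (a, b) \<in> r \<Longrightarrow> (b, a) \<in> r \<Longrightarrow> a = b"
    and refl: "\<And>a. a \<in> Field r \<Longrightarrow> (a, a) \<in> r"
    using r unfolding order_on_defs trans_def antisym_def refl_on_def by blast+
  have "(i, i) \<in> r" using ij(1) by (intro refl) (auto simp: Field_def)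
  then have "(i, i) \<in> s" using ij unfolding s_def underS_def by blast
  then show "i \<in> Field s" by (auto simp: Field_def)
  have sub: "underS r i \<subseteq> underS r j"
  proof
    fix b assume b: "b \<in> underS r i"
    then have bi: "(b, i) \<in> r" "b \<noteq> i" unfolding underS_def by blast+
    have "b \<noteq> j" using bi(1) ij antisym[of i j] by blast
    then show "b \<in> underS r j" using trans[OF bi(1) ij(1)] unfolding underS_def by blast
  qed
  moreover have "underS s i = underS r i"
    using sub ij unfolding s_def underS_def by blast
  ultimately show "Restr s (underS s i) = Restr r (underS r i)"
    unfolding s_def by blast
qed

lemma seq_cl_Restr_underS_subset:
  assumes "Well_order r" "A \<subseteq> topspace X" "m \<in> Field r"
  shows "seq_cl X (Restr r (underS r m)) A \<subseteq> seq_cl X r A"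
  using assms(1,3)
proof (induction r rule: Well_order_underS_induct)
  case (below r)
  have Field: "Field r \<noteq> {}" using below(3) by blast
  show ?case
  proof (cases "\<exists>g. is_greatest r g")
    case True
    then obtain g where g: "is_greatest r g" ..
    let ?s = "Restr r (underS r g)"
    have s: "Well_order ?s" by (rule Well_order_Restr[OF below(1)])
    have gF: "g \<in> Field r" and mg: "(m, g) \<in> r" using g below(3) unfolding is_greatest_def by blast+
    have "seq_cl X (Restr r (underS r m)) A \<subseteq> seq_cl X ?s A"
    proof (cases "m = g")
      case False
      from Restr_underS_Restr[OF below(1) mg False] below(2)[OF gF]
      show ?thesis by simp
    qed simp
    also have "\<dots> \<subseteq> cl1 X \<dots>"
      by (intro cl1_increasing seq_cl_subset_topspace s assms(2))
    finally show ?thesis by (simp add: seq_cl_greatest[OF below(1) g])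
  next
    case False
    show ?thesis
    proof (cases "underS r m = {}")
      case True
      then have "seq_cl X (Restr r (underS r m)) A = A"
        by (simp add: seq_cl_empty)
      with seq_cl_increasing[OF below(1) assms(2)] show ?thesis by simp
    next
      case nonempty: False
      with below(3) show ?thesis
        unfolding seq_cl_limit[OF below(1) Field False] by blast
    qed
  qed
qed

lemma Cinfinite_omega1: "Cinfinite omega1"
  by (rule Cinfinite_cardSuc[OF natLeq_Cinfinite])

lemma Well_order_omega1: "Well_order omega1"
  using Cinfinite_omega1 card_order_on_well_order_on by blast

text \<open>
  As \<open>\<omega>\<^sub>1\<close> is regular, a sequence in the union of the earlier stages lies in one stage \<open>i\<close>. Its
  limits are added at the stage \<open>m\<close> right after \<open>i\<close>, which is still below \<open>\<omega>\<^sub>1\<close>.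
\<close>

lemma cl1_seq_cl_omega1:
  assumes A: "A \<subseteq> topspace X"
  shows "cl1 X (seq_cl X omega1 A) \<subseteq> seq_cl X omega1 A"
proof
  fix x assume "x \<in> cl1 X (seq_cl X omega1 A)"
  then obtain a where a: "\<And>n :: nat. a n \<in> seq_cl X omega1 A" and lim: "limitin X a x sequentially"
    unfolding cl1_def by blast
  note wo = Well_order_omega1
  let ?As = "\<lambda>i. seq_cl X (Restr omega1 (underS omega1 i)) A"
  have unbounded: "\<exists>b\<in>Field omega1. i \<noteq> b \<and> (i, b) \<in> omega1" if "i \<in> Field omega1" for i
    using Cinfinite_omega1 that by (intro infinite_Card_order_limit) (auto simp: cinfinite_def)
  have "\<nexists>m. is_greatest omega1 m"
  proof
    assume "\<exists>m. is_greatest omega1 m"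
    then obtain m where m: "is_greatest omega1 m" ..
    then have "m \<in> Field omega1" by (simp add: is_greatest_def)
    from unbounded[OF this] obtain b where "b \<in> Field omega1" "m \<noteq> b" "(m, b) \<in> omega1" by blast
    moreover from this(1) m have "(b, m) \<in> omega1" by (simp add: is_greatest_def)
    ultimately show False using Well_order_antisym[OF wo] by blast
  qed
  moreover have "Field omega1 \<noteq> {}"
    using Cinfinite_omega1 by (auto simp: cinfinite_def)
  ultimately have "seq_cl X omega1 A \<subseteq> (\<Union>i\<in>Field omega1. ?As i)"
    by (subst seq_cl_limit[OF wo]) auto
  with a have range: "range a \<subseteq> (\<Union>i\<in>Field omega1. ?As i)" by blast
  have chain: "relChain omega1 ?As"
    unfolding relChain_def
  proof (intro allI impI)
    fix i j assume ij: "(i, j) \<in> omega1"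
    show "?As i \<subseteq> ?As j"
    proof (cases "i = j")
      case False
      note s = Restr_underS_Restr[OF wo ij False]
      from seq_cl_Restr_underS_subset[OF Well_order_Restr[OF wo] A s(1)] s(2)
      show ?thesis by simp
    qed simp
  qed
  have "|range a| \<le>o natLeq"
    by (rule ordLeq_ordIso_trans[OF card_of_image card_of_nat])
  with cardSuc_UNION[OF natLeq_Card_order _ chain range]
  obtain i where i: "i \<in> Field omega1" "range a \<subseteq> ?As i"
    using natLeq_cinfinite unfolding cinfinite_def by blast
  \<comment> \<open>The least element of \<^term>\<open>S\<close> is the successor of \<^term>\<open>i\<close>.\<close>
  define S where "S = {b \<in> Field omega1. i \<noteq> b \<and> (i, b) \<in> omega1}"
  have wo_rel: "wo_rel omega1" using wo by (simp add: wo_rel_def)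
  have S: "S \<subseteq> Field omega1" "S \<noteq> {}" using unbounded[OF i(1)] unfolding S_def by blast+
  define m where "m = wo_rel.minim omega1 S"
  have mS: "m \<in> S" unfolding m_def by (rule wo_rel.minim_in[OF wo_rel S])
  have m_least: "(m, b) \<in> omega1" if "b \<in> S" for b
    unfolding m_def by (rule wo_rel.minim_least[OF wo_rel S(1) that])
  have im: "(i, m) \<in> omega1" "i \<noteq> m" using mS unfolding S_def by blast+
  let ?s = "Restr omega1 (underS omega1 m)"
  note s = Restr_underS_Restr[OF wo im]
  have "is_greatest ?s i"
    unfolding is_greatest_def
  proof (intro conjI ballI s(1))
    fix b assume "b \<in> Field ?s"
    then have b: "b \<in> underS omega1 m" by (rule subsetD[OF Field_Restr_subset])
    then have bm: "(b, m) \<in> omega1" "b \<noteq> m" "b \<in> Field omega1"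
      unfolding underS_def by (auto simp: Field_def)
    have "b \<notin> S"
      using m_least[of b] bm(2) Well_order_antisym[OF wo bm(1)] by auto
    then have "(b, i) \<in> omega1"
      using bm(3) Well_order_total[OF wo bm(3) i(1)] Well_order_total[OF wo i(1) i(1)]
      unfolding S_def by auto
    with b im show "(b, i) \<in> ?s" unfolding underS_def by blast
  qed
  from seq_cl_greatest[OF Well_order_Restr[OF wo] this]
  have "?As m = cl1 X (?As i)" unfolding s(2) .
  moreover have "x \<in> cl1 X (?As i)" using i(2) lim unfolding cl1_def by blast
  moreover have "?As m \<subseteq> seq_cl X omega1 A"
    by (rule seq_cl_Restr_underS_subset[OF wo A]) (use mS in \<open>simp add: S_def\<close>)
  ultimately show "x \<in> seq_cl X omega1 A" by blast
qed

lemma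
  shows Well_order_seq_order: "Well_order (seq_order X)"
    and Field_seq_order: "Field (seq_order X) \<noteq> {}"
    and seq_cl_seq_order: "A \<subseteq> topspace X \<Longrightarrow> seq_cl X (seq_order X) A = seq_cl X omega1 A"
proof -
  let ?P = "\<lambda>r :: nat set rel. Field r \<noteq> {} \<and> (\<forall>A\<subseteq>topspace X. seq_cl X r A = seq_cl X omega1 A)"
  have P: "?P omega1" using Cinfinite_omega1 by (auto simp: cinfinite_def)
  note least = least_ordinal[of _ ?P, OF Well_order_omega1 P, folded seq_order_def]
  show "Well_order (seq_order X)" by (fact least(1))
  show "Field (seq_order X) \<noteq> {}" using least(2) by (rule conjunct1)
  show "seq_cl X (seq_order X) A = seq_cl X omega1 A" if "A \<subseteq> topspace X"
    using conjunct2[OF least(2)] that by simp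
qed


section \<open>The invariants of a $k^*$-metrizable $k$-space\<close>

context subproper_metric_image
begin

text \<open>
  The trace of \<open>S\<close> on a compact \<open>K\<close> is the image of the set of points over \<open>S\<close> in the closure of \<open>Z \<inter> f -` K\<close>. That
  set is sequentially closed in a compact metric space, hence compact, and so is its image.
\<close>

lemma sequentially_closed_imp_closed:
  assumes S: "S \<subseteq> topspace X" "cl1 X S \<subseteq> S"
  shows "closedin X S"
proof -
  have "closedin (subtopology X K) (K \<inter> S)" if K: "compactin X K" for K
  proof -
    let ?C = "mtopology closure_of (Z \<inter> f -` K)"
    have C: "?C \<subseteq> M" using closure_of_subset_topspace by force
    have "closedin mtopology (?C \<inter> f -` S)"
      unfolding metric_closedin_iff_sequentially_closed
    proof (intro conjI allI impI)
      show "?C \<inter> f -` S \<subseteq> M" using C by blast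
      fix \<sigma> l assume \<sigma>: "range \<sigma> \<subseteq> ?C \<inter> f -` S \<and> limitin mtopology \<sigma> l sequentially"
      then have "range \<sigma> \<subseteq> ?C \<and> limitin mtopology \<sigma> l sequentially" by simp
      with iffD1[OF metric_closedin_iff_sequentially_closed closedin_closure_of]
      have "l \<in> ?C" by presburger
      moreover have "limitin X (f \<circ> \<sigma>) (f l) sequentially"
        using continuous \<sigma> by (intro continuous_map_limit) auto
      then have "f l \<in> cl1 X S" using \<sigma> unfolding cl1_def
        by (intro CollectI exI[of _ "f \<circ> \<sigma>"]) auto
      then have "f l \<in> S" using S(2) by blast
      ultimately show "l \<in> ?C \<inter> f -` S" by simp
    qed
    then have "compactin mtopology (?C \<inter> f -` S)"
      by (rule closed_compactin[OF compact_lift[OF K] Int_lower1])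
    then have "compactin X (f ` (?C \<inter> f -` S))"
      using continuous by (rule image_compactin)
    moreover have "f ` (?C \<inter> f -` S) = f ` ?C \<inter> S" by blast
    moreover have "f ` ?C = K" by (rule image_compact_lift[OF K])
    ultimately have "closedin X (K \<inter> S)"
      using Hausdorff by (simp add: compactin_imp_closedin)
    then show ?thesis by (rule closedin_subset_topspace) blast
  qed
  with S(1) show ?thesis using k_space unfolding k_space_def by blast
qed

lemma seq_cl_omega1_of_dense:
  assumes D: "D \<subseteq> topspace X" "X closure_of D = topspace X"
  shows "seq_cl X omega1 D = topspace X"
proof
  show sub: "seq_cl X omega1 D \<subseteq> topspace X"
    by (rule seq_cl_subset_topspace[OF Well_order_omega1 D(1)])
  have "closedin X (seq_cl X omega1 D)"
    using sub cl1_seq_cl_omega1[OF D(1)] by (rule sequentially_closed_imp_closed)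
  with seq_cl_increasing[OF Well_order_omega1 D(1)]
  have "X closure_of D \<subseteq> seq_cl X omega1 D" by (rule closure_of_minimal)
  with D(2) show "topspace X \<subseteq> seq_cl X omega1 D" by simp
qed

text \<open>
  Induction along \<open>r\<close>: a network at the points of a stage bounds its discrete subsets, which is what
  is needed for a network at the points of the next stage; at a limit the networks are united.
\<close>

lemma network_on_seq_cl:
  fixes r :: "'b rel"
  assumes \<kappa>: "Cinfinite \<kappa>" and r: "Well_order r" "|Field r| \<le>o \<kappa>"
    and D: "D \<subseteq> topspace X" "|D| \<le>o \<kappa>"
  shows "\<exists>\<N>. network_on X (seq_cl X r D) \<N> \<and> |\<N>| \<le>o \<kappa>"
proof -
  let ?Q = "\<lambda>B. B \<subseteq> topspace X \<and> (\<exists>\<N>. network_on X B \<N> \<and> |\<N>| \<le>o \<kappa>)"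
  have "?Q (seq_cl X r D)"
  proof (rule seq_cl_closure_induct[where Q = ?Q, OF r(1) order_refl])
    have "network_on X D ((\<lambda>x. {x}) ` D)"
      using D(1) unfolding network_on_def by blast
    moreover have "|(\<lambda>x. {x}) ` D| \<le>o \<kappa>"
      by (rule ordLeq_transitive[OF card_of_image D(2)])
    ultimately show "?Q D" using D(1) by blast
  next
    fix B assume "?Q B"
    then obtain \<N> where B: "B \<subseteq> topspace X" and \<N>: "network_on X B \<N>" "|\<N>| \<le>o \<kappa>"
      by (elim exE conjE)
    have "\<exists>\<N>. network_on X (cl1 X B) \<N> \<and> |\<N>| \<le>o \<kappa>"
      using \<kappa> B
    proof (rule network_on_cl1)
      fix S assume "S \<subseteq> B" "discrete_subspace X S"
      from card_discrete_le_network_on[OF \<N>(1) this(2,1)] \<N>(2)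
      show "|S| \<le>o \<kappa>" by (rule ordLeq_transitive)
    qed
    with cl1_subset_topspace show "?Q (cl1 X B)" by (rule conjI)
  next
    fix I :: "'b set" and B assume I: "I \<subseteq> Field r" and Q: "\<And>i. i \<in> I \<Longrightarrow> ?Q (B i)"
    then have "\<forall>i\<in>I. \<exists>\<N>. network_on X (B i) \<N> \<and> |\<N>| \<le>o \<kappa>" by blast
    from bchoice[OF this] obtain \<N>
      where \<N>: "\<forall>i\<in>I. network_on X (B i) (\<N> i) \<and> |\<N> i| \<le>o \<kappa>" ..
    have "|\<Union>i\<in>I. \<N> i| \<le>o \<kappa>"
      using ordLeq_transitive[OF card_of_mono1[OF I] r(2)] _ \<kappa>
      by (rule UNION_Cinfinite_bound) (use \<N> in simp)
    moreover have "network_on X (\<Union>i\<in>I. B i) (\<Union>i\<in>I. \<N> i)"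
      by (rule network_on_UN) (use \<N> in simp)
    moreover have "(\<Union>i\<in>I. B i) \<subseteq> topspace X"
      by (rule UN_least) (use Q in simp)
    ultimately show "?Q (\<Union>i\<in>I. B i)" by blast
  qed
  then show ?thesis ..
qed

lemma nw_leI:
  assumes "network_on X (topspace X) \<N>" "|\<N>| \<le>o \<kappa>"
  shows "nw X \<le>o \<kappa>"
  using assms(1) unfolding network_on_topspace
  by (rule ordLeq_transitive[OF nw_le assms(2)])

lemma nw_le_seq_order_times_density:
  "nw X \<le>o |Field (seq_order X)| *c density_number X"
proof -
  let ?\<kappa> = "|Field (seq_order X)| *c density_number X"
  have "Cnotzero |Field (seq_order X)|"
    using Field_seq_order[of X] by (simp add: card_of_ordIso_czero_iff_empty card_of_card_order_on Field_card_of)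
  from ordLeq_cprod2[OF this Card_order_density]
  have d: "density_number X \<le>o ?\<kappa>" .
  show ?thesis
  proof (cases "finite (topspace X)")
    case True
    have "nw X \<le>o |topspace X|"
      by (rule ordLeq_transitive[OF nw_le_knw knw_le_card_if_finite[OF True]])
    also have "|topspace X| \<le>o density_number X"
      by (rule card_le_density_if_finite[OF Hausdorff True])
    also note d
    finally show ?thesis .
  next
    case False
    have "Cinfinite (density_number X)" by (rule Cinfinite_density[OF Hausdorff False])
    then have \<kappa>: "Cinfinite ?\<kappa>"
      using \<open>Cnotzero |Field (seq_order X)|\<close> by (intro Cinfinite_cprod2)
    from density_attained[of X]
    obtain D where D: "D \<subseteq> topspace X" "X closure_of D = topspace X" "|D| =o density_number X"
      by (elim exE conjE)
    have "Field (density_number X) \<noteq> {}"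
      using \<open>Cinfinite (density_number X)\<close> by (auto simp: cinfinite_def)
    then have "|Field (seq_order X)| \<le>o ?\<kappa>"
      unfolding cprod_def Field_card_of by (rule card_of_Times1)
    from network_on_seq_cl[OF \<kappa> Well_order_seq_order this D(1) ordIso_ordLeq_trans[OF D(3) d]]
    obtain \<N> where "network_on X (seq_cl X (seq_order X) D) \<N>" "|\<N>| \<le>o ?\<kappa>"
      by (elim exE conjE)
    then show ?thesis
      using nw_leI by (simp add: seq_cl_seq_order[OF D(1)] seq_cl_omega1_of_dense[OF D(1,2)])
  qed
qed

lemma nw_le_seq_density: "nw X \<le>o seq_density X"
proof (cases "finite (topspace X)")
  case True
  have "nw X \<le>o |topspace X|"
    by (rule ordLeq_transitive[OF nw_le_knw knw_le_card_if_finite[OF True]])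
  also have "|topspace X| \<le>o density_number X"
    by (rule card_le_density_if_finite[OF Hausdorff True])
  also note density_le_seq_density
  finally show ?thesis .
next
  case False
  have "Cinfinite (density_number X)" by (rule Cinfinite_density[OF Hausdorff False])
  then have \<kappa>: "Cinfinite (seq_density X)"
    using cinfinite_mono[OF density_le_seq_density] Card_order_seq_density by (intro conjI) blast+
  from seq_density_attained[of X]
  obtain D where D: "D \<subseteq> topspace X" "cl1 X D = topspace X" "|D| =o seq_density X"
    by (elim exE conjE)
  have "\<exists>\<N>. network_on X (cl1 X D) \<N> \<and> |\<N>| \<le>o seq_density X"
    using \<kappa> D(1)
  proof (rule network_on_cl1)
    fix S assume "S \<subseteq> D"
    then show "|S| \<le>o seq_density X"
      by (rule ordLeq_ordIso_trans[OF card_of_mono1 D(3)])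
  qed
  then obtain \<N> where "network_on X (cl1 X D) \<N>" "|\<N>| \<le>o seq_density X" by (elim exE conjE)
  then show ?thesis unfolding D(2) by (rule nw_leI)
qed

lemma small_dense_subset_of_lift:
  assumes "infinite (topspace X)"
  obtains E where "E \<subseteq> Z" "|E| \<le>o extent X" "Z \<subseteq> mtopology closure_of E"
proof -
  obtain E where "E \<subseteq> Z \<inter> f -` topspace X" "|E| \<le>o extent X"
      "Z \<inter> f -` topspace X \<subseteq> mtopology closure_of E"
    using extent_bound by (rule small_dense_lift[OF Cinfinite_extent[OF Hausdorff assms]])
  moreover have "Z \<inter> f -` topspace X = Z" using image_Z by auto
  ultimately show ?thesis by (intro that) simp_all
qed

lemma knw_le_extent: "knw X \<le>o extent X"
proof (cases "finite (topspace X)")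
  case True
  show ?thesis
    by (rule ordLeq_transitive[OF knw_le_card_if_finite[OF True] card_le_extent_if_finite[OF Hausdorff True]])
next
  case False
  obtain E where E: "E \<subseteq> Z" "|E| \<le>o extent X" "Z \<subseteq> mtopology closure_of E"
    by (rule small_dense_subset_of_lift[OF False])
  from k_network_of_dense[OF Cinfinite_extent[OF Hausdorff False] E(2,3)]
  obtain \<N> where "k_network X \<N>" "|\<N>| \<le>o extent X" by (elim exE conjE)
  then show ?thesis by (rule ordLeq_transitive[OF knw_le])
qed

lemma seq_density_le_extent: "seq_density X \<le>o extent X"
proof (cases "finite (topspace X)")
  case True
  from seq_density_le[OF order_refl cl1_topspace] card_le_extent_if_finite[OF Hausdorff True]
  show ?thesis by (rule ordLeq_transitive)
next
  case False
  obtain E where E: "E \<subseteq> Z" "|E| \<le>o extent X" "Z \<subseteq> mtopology closure_of E"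
    by (rule small_dense_subset_of_lift[OF False])
  have "f ` E \<subseteq> topspace X" using E(1) image_Z by blast
  from seq_density_le[OF this cl1_image_of_dense[OF E(1,3)]]
  show ?thesis
    by (rule ordLeq_transitive[OF _ ordLeq_transitive[OF card_of_image E(2)]])
qed

end

text \<open>
  The conclusions do not mention the metric, the map and the set \<open>Z\<close>, so these can be chosen inside the proof.
\<close>

lemma k_star_metrizable_k_space_inequalities:
  fixes X :: "'a topology"
  assumes "k_star_metrizable TYPE('m) X" and "k_space X"
  shows "knw X \<le>o extent X" "seq_density X \<le>o extent X" "nw X \<le>o seq_density X"
    "nw X \<le>o |Field (seq_order X)| *c density_number X"
proof -
  obtain T :: "'m topology" and f where T: "metrizable_space T" "subproper_map T X f"
    and Hausdorff: "Hausdorff_space X"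
    using assms(1) unfolding k_star_metrizable_def by blast
  obtain M d where M: "Metric_space M d" "T = Metric_space.mtopology M d"
    using T(1) unfolding metrizable_space_def by blast
  interpret Metric_space M d by (fact M(1))
  from T(2)[unfolded subproper_map_def]
  obtain Z where f: "continuous_map T X f" and Z: "Z \<subseteq> topspace T" "f ` Z = topspace X"
    and lift: "\<forall>K. precompactin X K \<longrightarrow> precompactin T (Z \<inter> f -` K)"
    by (elim exE conjE)
  interpret subproper_metric_image M d X f Z
  proof
    show "Hausdorff_space X" "k_space X" "continuous_map mtopology X f" "Z \<subseteq> M" "f ` Z = topspace X"
      using Hausdorff assms(2) f Z M(2) by simp_all
    fix K assume K: "compactin X K"
    then have "X closure_of K = K"
      using compactin_imp_closedin[OF Hausdorff] by (simp add: closure_of_closedin)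
    with K have "precompactin X K"
      unfolding precompactin_def by (simp add: compactin_subset_topspace)
    with lift show "compactin mtopology (mtopology closure_of (Z \<inter> f -` K))"
      unfolding precompactin_def M(2) by blast
  qed
  show "knw X \<le>o extent X" "seq_density X \<le>o extent X" "nw X \<le>o seq_density X"
    "nw X \<le>o |Field (seq_order X)| *c density_number X"
    by (fact knw_le_extent seq_density_le_extent nw_le_seq_density nw_le_seq_order_times_density)+
qed

theorem theorem5p3:
  fixes X :: "'a topology"
  assumes "k_star_metrizable TYPE('m) X" and "k_space X"
  shows "density_number X \<le>o knw X \<and>
         knw X =o nw X \<and>
         nw X =o spread X \<and>
         spread X =o extent X \<and>
         extent X =o lindelof_number X \<and>
         lindelof_number X =o meta_lindelof_number X *c density_number X \<and>
         meta_lindelof_number X *c density_number X =o seq_density X \<and>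
         seq_density X \<le>o |Field (seq_order X)| *c density_number X"
proof -
  note key = k_star_metrizable_k_space_inequalities[OF assms]
  note trans = ordLeq_transitive
  have Hausdorff: "Hausdorff_space X"
    using assms(1) unfolding k_star_metrizable_def by blast
  let ?md = "meta_lindelof_number X *c density_number X"
  note s_nw = spread_le_nw[of X] and nw_knw = nw_le_knw[of X] and e_s = extent_le_spread[of X]
    and e_l = extent_le_lindelof[of X] and l_md = lindelof_le_meta_lindelof_times_density[of X]
    and md_nw = meta_lindelof_times_density_le_nw[OF Hausdorff]
  have nw_e: "nw X \<le>o extent X" by (rule trans[OF nw_knw key(1)])
  have e_md: "extent X \<le>o ?md" by (rule trans[OF e_l l_md])
  show ?thesis
    unfolding ordIso_iff_ordLeq
  proof (intro conjI)
    show "density_number X \<le>o knw X" by (rule trans[OF density_le_nw nw_knw])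
    show "knw X \<le>o nw X" by (rule trans[OF key(1) trans[OF e_s s_nw]])
    show "nw X \<le>o knw X" by (fact nw_knw)
    show "nw X \<le>o spread X" by (rule trans[OF nw_e e_s])
    show "spread X \<le>o nw X" by (fact s_nw)
    show "spread X \<le>o extent X" by (rule trans[OF s_nw nw_e])
    show "extent X \<le>o spread X" by (fact e_s)
    show "extent X \<le>o lindelof_number X" by (fact e_l)
    show "lindelof_number X \<le>o extent X" by (rule trans[OF l_md trans[OF md_nw nw_e]])
    show "lindelof_number X \<le>o ?md" by (fact l_md)
    show "?md \<le>o lindelof_number X" by (rule trans[OF md_nw trans[OF nw_e e_l]])
    show "?md \<le>o seq_density X" by (rule trans[OF md_nw key(3)])
    show "seq_density X \<le>o ?md" by (rule trans[OF key(2) e_md])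
    show "seq_density X \<le>o |Field (seq_order X)| *c density_number X"
      by (rule trans[OF key(2) trans[OF trans[OF e_s s_nw] key(4)]])
  qed
qed

end
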